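(* There are infinitely many primitive Pythagorean triples $(a,b,c)$ such that the elliptic curve $$E_{a,b}:\; y^2=x(x+a^4)(x+b^4)$$ over $\mathbb{Q}$ has positive rank.
   Context: A Pythagorean triple is a triple $(a,b,c)$ of positive integers with $a^2+b^2=c^2$; it is primitive if $\gcd(a,b,c)=1$. The rank of an elliptic curve $E$ over $\mathbb{Q}$ is the rank of the finitely generated abelian group $E(\mathbb{Q})$; positive rank means that $E(\mathbb{Q})$ contains a point of infinite order. *)

theory Defs
  imports "HOL-Computational_Algebra.Polynomial_Factorial"
    "HOL-Computational_Algebra.Field_as_Ring" "HOL-Algebra.Group"
begin

definition primitive_pythagorean_triple :: "nat \<Rightarrow> nat \<Rightarrow> nat \<Rightarrow> bool" where
  "primitive_pythagorean_triple a b c \<longleftrightarrow>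
     a > 0 \<and> b > 0 \<and> c > 0 \<and> a^2 + b^2 = c^2 \<and> gcd a (gcd b c) = 1"

text \<open>
  An elliptic curve over the rationals is given by an equation \<open>y\<^sup>2 = f(x)\<close> with \<open>f\<close> a monic
  separable rational cubic; \<open>f\<close> itself represents the curve.  Coprimality of \<open>f\<close> and its
  derivative means that \<open>f\<close> has no repeated root in an algebraic closure, i.e. that the curve
  is smooth.
\<close>

definition elliptic_curve :: "rat poly \<Rightarrow> bool" where
  "elliptic_curve f \<longleftrightarrow> degree f = 3 \<and> lead_coeff f = 1 \<and> coprime f (pderiv f)"

datatype point = Infinity | Affine rat rat

text \<open>
  The chord-and-tangent law.  In the last equation \<open>m\<close> is the slope of the line through the two
  points (the tangent if they coincide).  Substituting the line into \<open>y\<^sup>2 = f(x)\<close>, the three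
  roots in \<open>x\<close> sum to \<open>m\<^sup>2 - coeff f 2\<close>; the third intersection point is then reflected in the
  \<open>x\<close>-axis.  For two points of the curve that are not opposite to each other,
  \<open>x\<^sub>1 = x\<^sub>2\<close> forces \<open>y\<^sub>1 = y\<^sub>2 \<noteq> 0\<close>, so no division by zero occurs.
\<close>

fun point_add :: "rat poly \<Rightarrow> point \<Rightarrow> point \<Rightarrow> point" where
  "point_add f Infinity Q = Q"
| "point_add f P Infinity = P"
| "point_add f (Affine x\<^sub>1 y\<^sub>1) (Affine x\<^sub>2 y\<^sub>2) =
     (if x\<^sub>1 = x\<^sub>2 \<and> y\<^sub>1 = - y\<^sub>2 then Infinity
      else let m = (if x\<^sub>1 = x\<^sub>2 then poly (pderiv f) x\<^sub>1 / (2 * y\<^sub>1) else (y\<^sub>2 - y\<^sub>1) / (x\<^sub>2 - x\<^sub>1));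
               x\<^sub>3 = m^2 - coeff f 2 - x\<^sub>1 - x\<^sub>2
           in Affine x\<^sub>3 (m * (x\<^sub>1 - x\<^sub>3) - y\<^sub>1))"

definition rational_points :: "rat poly \<Rightarrow> point monoid" where
  "rational_points f =
     \<lparr> carrier = insert Infinity {Affine x y | x y. y^2 = poly f x},
       mult = point_add f,
       one = Infinity \<rparr>"

definition positive_rank :: "rat poly \<Rightarrow> bool" where
  "positive_rank f \<longleftrightarrow>
     (\<exists>P \<in> carrier (rational_points f).
        \<forall>n::nat. n > 0 \<longrightarrow> P [^]\<^bsub>rational_points f\<^esub> n \<noteq> \<one>\<^bsub>rational_points f\<^esub>)"

definition E_curve :: "nat \<Rightarrow> nat \<Rightarrow> rat poly" where
  "E_curve a b = [:0, 1:] * [:of_nat a ^ 4, 1:] * [:of_nat b ^ 4, 1:]"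

lemma poly_E_curve:
  "poly (E_curve a b) x = x * (x + of_nat a ^ 4) * (x + of_nat b ^ 4)"
  by (simp add: E_curve_def algebra_simps)

lemma coprime_linear_poly:
  fixes p :: "rat poly"
  assumes "poly p (- c) \<noteq> 0"
  shows "coprime [:c, 1:] p"
proof -
  have "irreducible [:c, 1:]"
    by (rule irreducible_linear_field_poly) simp
  moreover have "\<not> [:c, 1:] dvd p"
    using assms poly_eq_0_iff_dvd[of p "- c"] by simp
  ultimately show ?thesis
    by (simp add: field_poly_irreducible_imp_prime prime_elem_imp_coprime)
qed

lemma elliptic_curve_E_curve:
  assumes "a > 0" "b > 0" "a \<noteq> b"
  shows "elliptic_curve (E_curve a b)"
proof -
  define A B :: rat where "A = of_nat a ^ 4" and "B = of_nat b ^ 4"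
  have "a ^ 4 \<noteq> b ^ 4"
    using assms by (simp add: power_eq_iff_eq_base)
  then have "of_nat (a ^ 4) \<noteq> (of_nat (b ^ 4) :: rat)"
    by (simp only: of_nat_eq_iff not_False_eq_True)
  then have AB: "A \<noteq> 0" "B \<noteq> 0" "A \<noteq> B"
    using assms by (simp_all add: A_def B_def)
  have f: "E_curve a b = [:0, A * B, A + B, 1:]"
    by (simp add: E_curve_def A_def B_def)
  have d: "poly (pderiv (E_curve a b)) x = A * B + 2 * (A + B) * x + 3 * x^2" for x
    by (simp add: f pderiv_pCons algebra_simps power2_eq_square)
  have "poly (pderiv (E_curve a b)) (- 0) \<noteq> 0"
    using AB by (simp add: d)
  moreover have "poly (pderiv (E_curve a b)) (- A) = A * (A - B)"
    by (simp add: d algebra_simps power2_eq_square)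
  moreover have "poly (pderiv (E_curve a b)) (- B) = B * (B - A)"
    by (simp add: d algebra_simps power2_eq_square)
  ultimately have "coprime [:0, 1:] (pderiv (E_curve a b))"
    "coprime [:A, 1:] (pderiv (E_curve a b))" "coprime [:B, 1:] (pderiv (E_curve a b))"
    using AB by (intro coprime_linear_poly; simp)+
  then have "coprime ([:0, 1:] * [:A, 1:] * [:B, 1:]) (pderiv (E_curve a b))"
    by (simp only: coprime_mult_left_iff simp_thms)
  then have "coprime (E_curve a b) (pderiv (E_curve a b))"
    by (simp only: E_curve_def A_def B_def)
  then show ?thesis
    by (simp add: elliptic_curve_def f)
qed

lemma primitive_pythagorean_triple_neq:
  assumes "primitive_pythagorean_triple a b c"
  shows "a \<noteq> b"
proof
  assume "a = b"
  then have eq: "2 * a^2 = c^2"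
    using assms by (simp add: primitive_pythagorean_triple_def)
  then have "even (c^2)"
    by (metis dvd_triv_left)
  then have "even c"
    by simp
  then obtain k where "c = 2 * k"
    by (elim evenE)
  then have "a^2 = 2 * k^2"
    using eq by (simp add: power2_eq_square)
  then have "even (a^2)"
    by (metis dvd_triv_left)
  then have "even a"
    by simp
  then have "2 dvd gcd a (gcd b c)"
    using \<open>even c\<close> \<open>a = b\<close> by (metis gcd_greatest)
  moreover have "gcd a (gcd b c) = 1"
    using assms by (simp only: primitive_pythagorean_triple_def)
  ultimately have "2 dvd (1::nat)"
    by (simp only:)
  then show False
    by simp
qed

lemma primitive_pythagorean_triple_elliptic_curve:
  assumes "primitive_pythagorean_triple a b c"
  shows "elliptic_curve (E_curve a b)"
proof (rule elliptic_curve_E_curve)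
  show "a > 0" "b > 0"
    using assms by (simp_all only: primitive_pythagorean_triple_def)
  show "a \<noteq> b"
    using assms by (rule primitive_pythagorean_triple_neq)
qed

end

theory Submission imports Defs begin

text \<open>
  The triples are those for which \<open>a\<^sup>2 - a b + b\<^sup>2\<close> is a square \<open>d\<^sup>2\<close> as well (with \<open>a\<close> and \<open>b\<close>
  integers of any sign; the curve depends only on their absolute values).  On such a curve
  \<open>P = (a b\<^sup>3, a b\<^sup>3 (a + b) d)\<close> is a rational point, because
  \<open>(a b\<^sup>3 + a\<^sup>4) (a b\<^sup>3 + b\<^sup>4) = a b\<^sup>3 (a + b)\<^sup>2 (a\<^sup>2 - a b + b\<^sup>2)\<close>.  The curve also carries the point
  \<open>R = (a\<^sup>2 b\<^sup>2, a\<^sup>2 b\<^sup>2 c\<^sup>2)\<close> of order four, and the \<open>x\<close>-coordinate of \<open>2 P + R\<close> is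
  \<open>(N / D)\<^sup>2\<close> with \<open>D = 3 c\<^sup>2 - 2 a b\<close>.  Since 3 divides one leg of every Pythagorean triple, 3
  divides \<open>D\<close>, and for one of the two signs of \<open>d\<close> it does not divide \<open>N\<close>.  So 3 occurs in the
  denominator, and \<open>2 P + R\<close> lies in the kernel of reduction modulo 3
  (\<open>positive_rank_E_curve\<close>).

  A nonzero point in the kernel of reduction has infinite order, because translations are
  \<open>p\<close>-adically almost isometries.  Let \<open>z = x / y\<close>, which vanishes at infinity and is
  injective on the kernel of reduction.  For points \<open>P\<close>, \<open>Q\<close>, \<open>Q'\<close> of the kernel, the difference
  \<open>z (Q + P) - z (Q' + P)\<close> is \<open>z Q - z Q'\<close> times a factor congruent to 1 modulo \<open>p\<^sup>2\<close>
  (\<open>translation_isometry\<close>).  Adding up such differences along the multiples of \<open>P\<close> gives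
  \<open>z (q m P) = z (m P) (q + p\<^sup>2 s)\<close> with \<open>s\<close> integral at \<open>p\<close>.  The last factor is nonzero for \<open>q = p\<close>
  and for \<open>q\<close> prime to \<open>p\<close>, so that no positive multiple of \<open>P\<close> vanishes
  (\<open>local_z_multiple_nonzero\<close>).

  Finally, with \<open>a = 2 m n\<close> and \<open>b = m\<^sup>2 - n\<^sup>2\<close>, the condition that \<open>a\<^sup>2 - a b + b\<^sup>2\<close> be a square defines
  a curve of genus one in \<open>m / n\<close>, birational to \<open>w\<^sup>2 = z (z - 2) (z + 4)\<close>.  On the latter, doubling
  \<open>(9/4, 15/8)\<close> repeatedly yields points with ever higher powers of 2 in their denominators; these
  powers are inherited by \<open>n\<close> and make the leg \<open>a\<close> arbitrarily large (\<open>large_triple\<close>).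
\<close>

section \<open>Rational numbers integral at a prime\<close>

definition p_integral :: "int \<Rightarrow> rat set" where
  "p_integral p = {of_int i / of_int n | i n. \<not> p dvd n}"

lemma p_integral_of_int:
  assumes "prime p"
  shows "of_int i \<in> p_integral p"
proof -
  have "\<not> p dvd 1"
    using assms not_prime_unit by blast
  moreover have "of_int i = (of_int i / of_int 1 :: rat)"
    by simp
  ultimately show ?thesis
    unfolding p_integral_def by blast
qed

lemma p_integralE:
  assumes "q \<in> p_integral p"
  obtains i n where "\<not> p dvd n" "n \<noteq> 0" "q = of_int i / of_int n"
  using assms unfolding p_integral_def by fastforce

lemma p_integralI:
  assumes "\<not> p dvd n" "q = of_int i / of_int n"
  shows "q \<in> p_integral p"
  using assms unfolding p_integral_def by blast

lemma p_integral_add: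
  assumes "prime p" "q \<in> p_integral p" "r \<in> p_integral p"
  shows "q + r \<in> p_integral p"
proof -
  obtain i n where 1: "\<not> p dvd n" "n \<noteq> 0" "q = of_int i / of_int n"
    using assms(2) by (rule p_integralE)
  obtain j k where 2: "\<not> p dvd k" "k \<noteq> 0" "r = of_int j / of_int k"
    using assms(3) by (rule p_integralE)
  have "q + r = of_int (i * k + j * n) / of_int (n * k)"
    using 1 2 by (simp add: field_simps)
  moreover have "\<not> p dvd n * k"
    using 1 2 assms(1) by (simp add: prime_dvd_mult_iff)
  ultimately show ?thesis
    by (rule p_integralI[rotated])
qed

lemma p_integral_mult:
  assumes "prime p" "q \<in> p_integral p" "r \<in> p_integral p"
  shows "q * r \<in> p_integral p"
proof -
  obtain i n where 1: "\<not> p dvd n" "n \<noteq> 0" "q = of_int i / of_int n"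
    using assms(2) by (rule p_integralE)
  obtain j k where 2: "\<not> p dvd k" "k \<noteq> 0" "r = of_int j / of_int k"
    using assms(3) by (rule p_integralE)
  have "q * r = of_int (i * j) / of_int (n * k)"
    by (simp add: 1 2)
  moreover have "\<not> p dvd n * k"
    using 1 2 assms(1) by (simp add: prime_dvd_mult_iff)
  ultimately show ?thesis
    by (rule p_integralI[rotated])
qed

lemma p_integral_minus:
  assumes "prime p" "q \<in> p_integral p"
  shows "- q \<in> p_integral p"
  using p_integral_mult[OF assms(1) p_integral_of_int[OF assms(1), of "-1"] assms(2)] by simp

lemma p_integral_diff:
  assumes "prime p" "q \<in> p_integral p" "r \<in> p_integral p"
  shows "q - r \<in> p_integral p"
  using p_integral_add[OF assms(1,2) p_integral_minus[OF assms(1,3)]] by simp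

lemma p_integral_power:
  assumes "prime p" "q \<in> p_integral p"
  shows "q ^ k \<in> p_integral p"
proof (induction k)
  case 0
  show ?case
    using p_integral_of_int[OF assms(1), of 1] by simp
next
  case (Suc k)
  then show ?case
    using p_integral_mult[OF assms] by simp
qed

text \<open>
  The ring of \<open>p\<close>-integral rationals is local: an integer prime to \<open>p\<close> stays a unit after a change
  by a multiple of \<open>p\<close>.
\<close>

lemma p_unit:
  assumes "prime p" "\<not> p dvd m" "s \<in> p_integral p"
  shows "of_int m + of_int p * s \<noteq> 0" "1 / (of_int m + of_int p * s) \<in> p_integral p"
proof -
  obtain i n where 1: "\<not> p dvd n" "n \<noteq> 0" "s = of_int i / of_int n"
    using assms(3) by (rule p_integralE)
  have eq: "of_int m + of_int p * s = of_int (m * n + p * i) / of_int n"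
    by (simp add: 1 add_divide_distrib)
  have "\<not> p dvd m * n"
    using 1 assms by (simp add: prime_dvd_mult_iff)
  then have nd: "\<not> p dvd m * n + p * i"
    by (simp add: dvd_add_left_iff)
  then have "m * n + p * i \<noteq> 0"
    by (metis dvd_0_right)
  then show "of_int m + of_int p * s \<noteq> 0"
    using 1(2) by (simp only: eq divide_eq_0_iff of_int_eq_0_iff simp_thms)
  have "1 / (of_int m + of_int p * s) = of_int n / of_int (m * n + p * i)"
    by (simp only: eq) simp
  then show "1 / (of_int m + of_int p * s) \<in> p_integral p"
    using nd by (rule p_integralI[rotated])
qed

text \<open>
  The ring of \<open>p\<close>-integral rationals is a valuation ring, with maximal ideal generated by \<open>p\<close>.
\<close>

lemma inverse_not_p_integral:
  assumes "prime p" "q \<notin> p_integral p"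
  obtains s where "s \<in> p_integral p" "1 / q = of_int p * s"
proof -
  obtain i n where in_: "quotient_of q = (i, n)"
    by (rule prod.exhaust)
  have q: "q = of_int i / of_int n" and cop: "coprime i n"
    using in_ by (simp_all add: quotient_of_div quotient_of_coprime)
  have "p dvd n"
    using assms(2) q p_integralI by blast
  then obtain k where k: "n = p * k" ..
  have "\<not> p dvd i"
    using cop \<open>p dvd n\<close> assms(1) by (metis coprime_common_divisor not_prime_unit)
  then have "of_int k / of_int i \<in> p_integral p"
    by (rule p_integralI[OF _ refl])
  moreover have "1 / q = of_int p * (of_int k / of_int i)"
    by (simp add: q k)
  ultimately show thesis
    by (rule that)
qed

lemma p_divides_if_p_divides_square:
  assumes "prime p" "s \<in> p_integral p" "q\<^sup>2 = of_int p * s"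
  obtains r where "r \<in> p_integral p" "q = of_int p * r"
proof (cases "q = 0")
  case True
  then show thesis
    using that[of 0] p_integral_of_int[OF assms(1), of 0] by simp
next
  case False
  have nu: "1 / q \<notin> p_integral p"
  proof
    assume "1 / q \<in> p_integral p"
    then have "s * (1 / q)\<^sup>2 \<in> p_integral p"
      using assms(1,2) by (intro p_integral_mult p_integral_power)
    then have "- (s * (1 / q)\<^sup>2) \<in> p_integral p"
      by (rule p_integral_minus[OF assms(1)])
    then have "of_int 1 + of_int p * (- (s * (1 / q)\<^sup>2)) \<noteq> 0"
      using assms(1) not_prime_unit by (intro p_unit(1)) blast+
    then have "1 \<noteq> q\<^sup>2 * (1 / q)\<^sup>2"
      by (simp add: assms(3))
    then show False
      using False by (simp add: power_divide)
  qed
  then obtain r where "r \<in> p_integral p" "1 / (1 / q) = of_int p * r"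
    using inverse_not_p_integral[OF assms(1)] by blast
  then show thesis
    using that by simp
qed


lemma p_integral_one: "prime p \<Longrightarrow> 1 \<in> p_integral p"
  using p_integral_of_int[of p 1] by simp

lemma p_integral_zero: "prime p \<Longrightarrow> 0 \<in> p_integral p"
  using p_integral_of_int[of p 0] by simp

lemma p_integral_numeral: "prime p \<Longrightarrow> numeral k \<in> p_integral p"
  using p_integral_of_int[of p "numeral k"] by simp

lemmas p_integral_intros =
  p_integral_of_int p_integral_zero p_integral_one p_integral_numeral
  p_integral_add p_integral_mult p_integral_minus p_integral_diff p_integral_power

text \<open>
  Congruence of \<open>p\<close>-integral rationals modulo a rational \<open>e\<close> that need not be a power of \<open>p\<close>: below,
  \<open>e\<close> is the difference of two local parameters, and congruence modulo \<open>e\<close> works as a Lipschitz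
  condition that survives sums, products and quotients by units.
\<close>

definition p_cong :: "int \<Rightarrow> rat \<Rightarrow> rat \<Rightarrow> rat \<Rightarrow> bool" where
  "p_cong p e q r \<longleftrightarrow>
     q \<in> p_integral p \<and> r \<in> p_integral p \<and> (\<exists>s \<in> p_integral p. q - r = e * s)"

lemma p_congI:
  "q \<in> p_integral p \<Longrightarrow> r \<in> p_integral p \<Longrightarrow> s \<in> p_integral p \<Longrightarrow> q - r = e * s
    \<Longrightarrow> p_cong p e q r"
  unfolding p_cong_def by blast

lemma p_congE:
  assumes "p_cong p e q r"
  obtains s where "s \<in> p_integral p" "q - r = e * s" "q \<in> p_integral p" "r \<in> p_integral p"
  using assms unfolding p_cong_def by blast

lemma p_cong_refl: "prime p \<Longrightarrow> q \<in> p_integral p \<Longrightarrow> p_cong p e q q"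
  by (rule p_congI[of _ _ _ 0]) (simp_all add: p_integral_zero)

lemma p_cong_add:
  assumes "prime p" "p_cong p e q r" "p_cong p e q' r'"
  shows "p_cong p e (q + q') (r + r')"
proof -
  obtain s where s: "s \<in> p_integral p" "q - r = e * s" "q \<in> p_integral p" "r \<in> p_integral p"
    using assms(2) by (rule p_congE)
  obtain s' where s': "s' \<in> p_integral p" "q' - r' = e * s'" "q' \<in> p_integral p" "r' \<in> p_integral p"
    using assms(3) by (rule p_congE)
  have "q + q' - (r + r') = (q - r) + (q' - r')"
    by simp
  also have "\<dots> = e * (s + s')"
    by (simp only: s s' distrib_left)
  finally show ?thesis
    using s s' assms(1) by (intro p_congI[of _ _ _ "s + s'"] p_integral_add)
qed

lemma p_cong_mult:
  assumes "prime p" "p_cong p e q r" "p_cong p e q' r'"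
  shows "p_cong p e (q * q') (r * r')"
proof -
  obtain s where s: "s \<in> p_integral p" "q - r = e * s" "q \<in> p_integral p" "r \<in> p_integral p"
    using assms(2) by (rule p_congE)
  obtain s' where s': "s' \<in> p_integral p" "q' - r' = e * s'" "q' \<in> p_integral p" "r' \<in> p_integral p"
    using assms(3) by (rule p_congE)
  have "q * q' - r * r' = (q - r) * q' + r * (q' - r')"
    by (simp add: algebra_simps)
  also have "\<dots> = e * (s * q' + r * s')"
    by (simp only: s(2) s'(2)) (simp add: algebra_simps)
  finally show ?thesis
    using s s' assms(1)
    by (intro p_congI[of _ _ _ "s * q' + r * s'"] p_integral_add p_integral_mult)
qed

lemma p_cong_diff:
  assumes "prime p" "p_cong p e q r" "p_cong p e q' r'"
  shows "p_cong p e (q - q') (r - r')"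
proof -
  have "p_cong p e (- 1) (- 1)"
    using assms(1) by (intro p_cong_refl p_integral_intros)
  then have "p_cong p e (q + (- 1) * q') (r + (- 1) * r')"
    using assms by (intro p_cong_add p_cong_mult)
  then show ?thesis
    by simp
qed

lemma p_cong_power:
  assumes "prime p" "p_cong p e q r"
  shows "p_cong p e (q ^ k) (r ^ k)"
proof (induction k)
  case 0
  then show ?case
    using assms(1) by (simp add: p_cong_refl p_integral_one)
next
  case (Suc k)
  then show ?case
    using p_cong_mult[OF assms] by simp
qed

lemma p_cong_inverse:
  assumes "prime p" "p_cong p e q r" "q \<noteq> 0" "r \<noteq> 0"
    and "1 / q \<in> p_integral p" "1 / r \<in> p_integral p"
  shows "p_cong p e (1 / q) (1 / r)"
proof -
  obtain s where s: "s \<in> p_integral p" "q - r = e * s"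
    using assms(2) by (rule p_congE)
  have "1 / q - 1 / r = (q - r) * (- (1 / q * (1 / r)))"
    using assms(3,4) by (simp add: field_simps)
  also have "\<dots> = e * (- (s * (1 / q * (1 / r))))"
    by (simp add: s(2))
  finally show ?thesis
    using s assms by (intro p_congI[of _ _ _ "- (s * (1 / q * (1 / r)))"] p_integral_intros)
qed

lemma p_cong_scale:
  assumes "prime p" "p_cong p e q r" "k \<in> p_integral p"
  shows "p_cong p (k * e) (k * q) (k * r)"
proof -
  obtain s where s: "s \<in> p_integral p" "q - r = e * s" "q \<in> p_integral p" "r \<in> p_integral p"
    using assms(2) by (rule p_congE)
  have "k * q - k * r = k * e * s"
    by (simp only: right_diff_distrib[symmetric] s(2) mult.assoc)
  then show ?thesis
    using s assms by (intro p_congI[of _ _ _ s] p_integral_mult)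
qed

lemmas p_cong_intros = p_cong_add p_cong_mult p_cong_diff p_cong_power

section \<open>The kernel of reduction\<close>

text \<open>
  In the coordinates \<open>z = x / y\<close> and \<open>w = 1 / y\<close> the point at infinity is the origin, and lines
  remain lines.
\<close>

fun local_z :: "point \<Rightarrow> rat" where
  "local_z Infinity = 0"
| "local_z (Affine x y) = x / y"

fun local_w :: "point \<Rightarrow> rat" where
  "local_w Infinity = 0"
| "local_w (Affine x y) = 1 / y"

locale p_integral_cubic =
  fixes f :: "rat poly" and p :: int
  assumes prime_p: "prime p"
    and degree_f: "degree f = 3" and monic_f: "lead_coeff f = 1"
    and coeff_integral: "coeff f i \<in> p_integral p"
begin

abbreviation "a2 \<equiv> coeff f 2"
abbreviation "a4 \<equiv> coeff f 1"
abbreviation "a6 \<equiv> coeff f 0"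

lemma f_eq: "f = [:a6, a4, a2, 1:]"
proof (rule poly_eqI)
  fix n
  show "coeff f n = coeff [:a6, a4, a2, 1:] n"
  proof (cases "n \<le> 3")
    case True
    then have "n = 0 \<or> n = 1 \<or> n = 2 \<or> n = 3"
      by linarith
    then show ?thesis
      using monic_f degree_f by (auto simp: numeral_2_eq_2 numeral_3_eq_3)
  next
    case False
    then have "coeff f n = 0" "coeff [:a6, a4, a2, 1:] n = 0"
      using degree_f by (intro coeff_eq_0; simp)+
    then show ?thesis
      by (simp only:)
  qed
qed

lemma poly_f: "poly f x = x ^ 3 + a2 * x\<^sup>2 + a4 * x + a6"
  by (subst f_eq) (simp add: algebra_simps power2_eq_square power3_eq_cube)

lemma poly_pderiv_f: "poly (pderiv f) x = 3 * x\<^sup>2 + 2 * a2 * x + a4"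
  by (subst f_eq) (simp add: pderiv_pCons algebra_simps power2_eq_square)

text \<open>
  A point reduces to infinity modulo \<open>p\<close> if its coordinates \<open>(z, w)\<close> reduce to the origin.
\<close>

definition kernel :: "point set" where
  "kernel = insert Infinity {Affine x y | x y. y \<noteq> 0 \<and> y\<^sup>2 = poly f x \<and>
     (\<exists>s \<in> p_integral p. x / y = of_int p * s) \<and> (\<exists>t \<in> p_integral p. 1 / y = of_int p * t)}"

lemma kernelE:
  assumes "P \<in> kernel"
  obtains s t where "s \<in> p_integral p" "t \<in> p_integral p"
    "local_z P = of_int p * s" "local_w P = of_int p * t"
proof (cases P)
  case Infinity
  then show thesis
    using that[of 0 0] p_integral_zero[OF prime_p] by simp
next
  case (Affine x y)
  then show thesis
    using that assms by (auto simp: kernel_def)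
qed

lemma local_equation:
  assumes "P \<in> kernel" "z = local_z P" "w = local_w P"
  shows "w = z ^ 3 + a2 * z\<^sup>2 * w + a4 * z * w\<^sup>2 + a6 * w ^ 3"
proof (cases P)
  case Infinity
  then show ?thesis
    using assms by simp
next
  case (Affine x y)
  then have y: "y \<noteq> 0" "y\<^sup>2 = x ^ 3 + a2 * x\<^sup>2 + a4 * x + a6" and zw: "z = x / y" "w = 1 / y"
    using assms by (auto simp: kernel_def poly_f)
  have "w = y\<^sup>2 / y ^ 3"
    using y(1) by (simp add: zw power2_eq_square power3_eq_cube)
  also have "\<dots> = z ^ 3 + a2 * z\<^sup>2 * w + a4 * z * w\<^sup>2 + a6 * w ^ 3"
    using y(1) unfolding zw y(2) by (simp add: field_simps power2_eq_square power3_eq_cube)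
  finally show ?thesis .
qed

text \<open>
  The slope \<open>(w\<^sub>2 - w\<^sub>1) / (z\<^sub>2 - z\<^sub>1)\<close> of a chord in the \<open>(z, w)\<close>-plane becomes 0/0 for a tangent, and
  \<open>p\<close>-integrality cannot be seen from it.  Subtracting the equations of the two points and
  collecting the multiples of \<open>w\<^sub>2 - w\<^sub>1\<close> and of \<open>z\<^sub>2 - z\<^sub>1\<close> rewrites it as a quotient with a unit as
  denominator, which is also the slope of the tangent when the points coincide.
\<close>

definition slope_den :: "rat \<Rightarrow> rat \<Rightarrow> rat \<Rightarrow> rat" where
  "slope_den w\<^sub>1 z\<^sub>2 w\<^sub>2 =
     1 - a2 * z\<^sub>2\<^sup>2 - a4 * z\<^sub>2 * (w\<^sub>1 + w\<^sub>2) - a6 * (w\<^sub>1\<^sup>2 + w\<^sub>1 * w\<^sub>2 + w\<^sub>2\<^sup>2)"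

definition slope_num :: "rat \<Rightarrow> rat \<Rightarrow> rat \<Rightarrow> rat" where
  "slope_num z\<^sub>1 w\<^sub>1 z\<^sub>2 = z\<^sub>1\<^sup>2 + z\<^sub>1 * z\<^sub>2 + z\<^sub>2\<^sup>2 + a2 * w\<^sub>1 * (z\<^sub>1 + z\<^sub>2) + a4 * w\<^sub>1\<^sup>2"

definition slope :: "rat \<Rightarrow> rat \<Rightarrow> rat \<Rightarrow> rat \<Rightarrow> rat" where
  "slope z\<^sub>1 w\<^sub>1 z\<^sub>2 w\<^sub>2 = slope_num z\<^sub>1 w\<^sub>1 z\<^sub>2 / slope_den w\<^sub>1 z\<^sub>2 w\<^sub>2"

text \<open>
  Substituting the line \<open>w = \<alpha> z + \<beta>\<close> into \<open>w = z\<^sup>3 + a\<^sub>2 z\<^sup>2 w + a\<^sub>4 z w\<^sup>2 + a\<^sub>6 w\<^sup>3\<close> gives a cubic in \<open>z\<close>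
  whose coefficients at \<open>z\<^sup>3\<close> and \<open>z\<^sup>2\<close> are \<open>chord_den \<alpha>\<close> and \<open>\<beta>\<close> times \<open>chord_num \<alpha>\<close>.
\<close>

definition chord_den :: "rat \<Rightarrow> rat" where
  "chord_den \<alpha> = 1 + a2 * \<alpha> + a4 * \<alpha>\<^sup>2 + a6 * \<alpha> ^ 3"

definition chord_num :: "rat \<Rightarrow> rat" where
  "chord_num \<alpha> = a2 + 2 * a4 * \<alpha> + 3 * a6 * \<alpha>\<^sup>2"

lemma slope_eq:
  assumes "w\<^sub>1 = z\<^sub>1 ^ 3 + a2 * z\<^sub>1\<^sup>2 * w\<^sub>1 + a4 * z\<^sub>1 * w\<^sub>1\<^sup>2 + a6 * w\<^sub>1 ^ 3"
    and "w\<^sub>2 = z\<^sub>2 ^ 3 + a2 * z\<^sub>2\<^sup>2 * w\<^sub>2 + a4 * z\<^sub>2 * w\<^sub>2\<^sup>2 + a6 * w\<^sub>2 ^ 3"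
  shows "slope_den w\<^sub>1 z\<^sub>2 w\<^sub>2 * (w\<^sub>2 - w\<^sub>1) = slope_num z\<^sub>1 w\<^sub>1 z\<^sub>2 * (z\<^sub>2 - z\<^sub>1)"
  using assms unfolding slope_den_def slope_num_def by algebra

lemma one_plus_p_mult:
  assumes "s \<in> p_integral p"
  shows "1 + of_int p * s \<noteq> 0" "1 / (1 + of_int p * s) \<in> p_integral p"
  using p_unit[OF prime_p, of 1 s] assms prime_p not_prime_unit by auto

lemma slope_den_unit:
  assumes "w\<^sub>1 = of_int p * t\<^sub>1" "z\<^sub>2 = of_int p * s\<^sub>2" "w\<^sub>2 = of_int p * t\<^sub>2"
    and "t\<^sub>1 \<in> p_integral p" "s\<^sub>2 \<in> p_integral p" "t\<^sub>2 \<in> p_integral p"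
  shows "slope_den w\<^sub>1 z\<^sub>2 w\<^sub>2 \<noteq> 0" "1 / slope_den w\<^sub>1 z\<^sub>2 w\<^sub>2 \<in> p_integral p"
proof -
  define s where "s = - (of_int p * (a2 * s\<^sub>2\<^sup>2 + a4 * s\<^sub>2 * (t\<^sub>1 + t\<^sub>2) + a6 * (t\<^sub>1\<^sup>2 + t\<^sub>1 * t\<^sub>2 + t\<^sub>2\<^sup>2)))"
  have "s \<in> p_integral p"
    unfolding s_def using assms prime_p by (intro p_integral_intros coeff_integral)
  moreover have "slope_den w\<^sub>1 z\<^sub>2 w\<^sub>2 = 1 + of_int p * s"
    by (simp add: slope_den_def s_def assms(1-3) algebra_simps power2_eq_square)
  ultimately show "slope_den w\<^sub>1 z\<^sub>2 w\<^sub>2 \<noteq> 0" "1 / slope_den w\<^sub>1 z\<^sub>2 w\<^sub>2 \<in> p_integral p"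
    using one_plus_p_mult by simp_all
qed

lemma chord_den_unit:
  assumes "\<alpha> = of_int p * s" "s \<in> p_integral p"
  shows "chord_den \<alpha> \<noteq> 0" "1 / chord_den \<alpha> \<in> p_integral p"
proof -
  have "s * (a2 + a4 * \<alpha> + a6 * \<alpha>\<^sup>2) \<in> p_integral p"
    unfolding assms(1) using assms(2) prime_p by (intro p_integral_intros coeff_integral)
  moreover have "chord_den \<alpha> = 1 + of_int p * (s * (a2 + a4 * \<alpha> + a6 * \<alpha>\<^sup>2))"
    by (simp add: chord_den_def assms(1) algebra_simps power2_eq_square power3_eq_cube)
  ultimately show "chord_den \<alpha> \<noteq> 0" "1 / chord_den \<alpha> \<in> p_integral p"
    using one_plus_p_mult by simp_all
qed

text \<open>
  If the two values of \<open>z\<close> agree, then by \<open>slope_eq\<close> the difference of the values of \<open>w\<close> is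
  annihilated by a unit.
\<close>

lemma local_z_inj:
  assumes "P \<in> kernel" "Q \<in> kernel" "local_z P = local_z Q"
  shows "P = Q"
proof -
  obtain s\<^sub>1 t\<^sub>1 where 1: "s\<^sub>1 \<in> p_integral p" "t\<^sub>1 \<in> p_integral p"
    "local_z P = of_int p * s\<^sub>1" "local_w P = of_int p * t\<^sub>1"
    using assms(1) by (rule kernelE)
  obtain s\<^sub>2 t\<^sub>2 where 2: "s\<^sub>2 \<in> p_integral p" "t\<^sub>2 \<in> p_integral p"
    "local_z Q = of_int p * s\<^sub>2" "local_w Q = of_int p * t\<^sub>2"
    using assms(2) by (rule kernelE)
  have "slope_den (local_w P) (local_z Q) (local_w Q) * (local_w Q - local_w P) = 0"
    using slope_eq[OF local_equation[OF assms(1) refl refl] local_equation[OF assms(2) refl refl]]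
      assms(3) by simp
  moreover have "slope_den (local_w P) (local_z Q) (local_w Q) \<noteq> 0"
    using 1 2 by (intro slope_den_unit)
  ultimately have w: "local_w Q = local_w P"
    by simp
  show ?thesis
  proof (cases P)
    case Infinity
    then show ?thesis
      using w assms(2) by (cases Q) (auto simp: kernel_def)
  next
    case (Affine x y)
    then show ?thesis
      using w assms by (cases Q) (auto simp: kernel_def)
  qed
qed

text \<open>
  This translates the chord-and-tangent law from the line \<open>y = m x + \<nu>\<close> to the same line
  \<open>w = \<alpha> z + 1 / \<nu>\<close>.  The assumption \<open>double\<close> treats chords and tangents alike: it says that the
  divided difference of \<open>f(x) - (m x + \<nu>)\<^sup>2\<close> at \<open>x\<^sub>1\<close> and \<open>x\<^sub>2\<close> vanishes, and for \<open>x\<^sub>1 = x\<^sub>2\<close> that is its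
  derivative.  The cubic therefore has the roots \<open>x\<^sub>1\<close>, \<open>x\<^sub>2\<close> and \<open>x\<^sub>3\<close>, and everything follows from
  Vieta's formulas \<open>e1\<close>, \<open>e2\<close>, \<open>e3\<close>.
\<close>

lemma third_intersection:
  fixes x\<^sub>1 y\<^sub>1 x\<^sub>2 y\<^sub>2 m \<nu> :: rat
  defines "x\<^sub>3 \<equiv> m\<^sup>2 - a2 - x\<^sub>1 - x\<^sub>2" and "\<alpha> \<equiv> - m / \<nu>"
  assumes y: "y\<^sub>1 = m * x\<^sub>1 + \<nu>" "y\<^sub>2 = m * x\<^sub>2 + \<nu>" "y\<^sub>1 \<noteq> 0" "y\<^sub>2 \<noteq> 0"
    and curve: "y\<^sub>1\<^sup>2 = poly f x\<^sub>1"
    and double: "x\<^sub>1\<^sup>2 + x\<^sub>1 * x\<^sub>2 + x\<^sub>2\<^sup>2 + (a2 - m\<^sup>2) * (x\<^sub>1 + x\<^sub>2) + (a4 - 2 * m * \<nu>) = 0"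
    and \<nu>: "\<nu> \<noteq> 0" and den: "chord_den \<alpha> \<noteq> 0"
  defines "y\<^sub>3 \<equiv> m * (x\<^sub>1 - x\<^sub>3) - y\<^sub>1"
  shows "y\<^sub>3 \<noteq> 0" "y\<^sub>3\<^sup>2 = poly f x\<^sub>3"
    "x\<^sub>3 / y\<^sub>3 = x\<^sub>1 / y\<^sub>1 + x\<^sub>2 / y\<^sub>2 + 1 / \<nu> * chord_num \<alpha> * (1 / chord_den \<alpha>)"
    "1 / y\<^sub>3 = \<alpha> * (x\<^sub>3 / y\<^sub>3) - 1 / \<nu>"
proof -
  have y3: "- y\<^sub>3 = m * x\<^sub>3 + \<nu>"
    using y(1) by (simp add: y\<^sub>3_def algebra_simps)
  have e1: "x\<^sub>1 + x\<^sub>2 + x\<^sub>3 = m\<^sup>2 - a2"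
    by (simp add: x\<^sub>3_def)
  have e2: "x\<^sub>1 * x\<^sub>2 + x\<^sub>1 * x\<^sub>3 + x\<^sub>2 * x\<^sub>3 = a4 - 2 * m * \<nu>"
    using double unfolding x\<^sub>3_def by algebra
  have curve': "(m * x\<^sub>1 + \<nu>)\<^sup>2 = x\<^sub>1 ^ 3 + a2 * x\<^sub>1\<^sup>2 + a4 * x\<^sub>1 + a6"
    using curve y(1) by (simp add: poly_f)
  have e3: "x\<^sub>1 * x\<^sub>2 * x\<^sub>3 = \<nu>\<^sup>2 - a6"
    using curve' e1 e2 by algebra
  show "y\<^sub>3\<^sup>2 = poly f x\<^sub>3"
    unfolding poly_f using y3 e1 e2 e3 by algebra
  have m_eq: "m = - \<alpha> * \<nu>"
    using \<nu> by (simp add: \<alpha>_def)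
  have "y\<^sub>1 * y\<^sub>2 * (- y\<^sub>3) = \<nu> ^ 3 - a2 * m * \<nu>\<^sup>2 + a4 * m\<^sup>2 * \<nu> - a6 * m ^ 3"
    using y(1,2) y3 e1 e2 e3 by algebra
  also have "\<dots> = \<nu> ^ 3 * chord_den \<alpha>"
    unfolding chord_den_def using m_eq by algebra
  finally have prod: "y\<^sub>1 * y\<^sub>2 * (- y\<^sub>3) = \<nu> ^ 3 * chord_den \<alpha>" .
  then show y3_nz: "y\<^sub>3 \<noteq> 0"
    using \<nu> den by auto
  have "x\<^sub>1 * y\<^sub>2 * (- y\<^sub>3) + x\<^sub>2 * y\<^sub>1 * (- y\<^sub>3) + x\<^sub>3 * y\<^sub>1 * y\<^sub>2
      = - 3 * a6 * m\<^sup>2 + 2 * a4 * m * \<nu> - a2 * \<nu>\<^sup>2"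
    using y(1,2) y3 e1 e2 e3 by algebra
  also have "\<dots> = - (\<nu>\<^sup>2 * chord_num \<alpha>)"
    unfolding chord_num_def using m_eq by algebra
  finally have sum: "x\<^sub>1 * y\<^sub>2 * (- y\<^sub>3) + x\<^sub>2 * y\<^sub>1 * (- y\<^sub>3) + x\<^sub>3 * y\<^sub>1 * y\<^sub>2 = - (\<nu>\<^sup>2 * chord_num \<alpha>)" .
  have "x\<^sub>1 / y\<^sub>1 + x\<^sub>2 / y\<^sub>2 - x\<^sub>3 / y\<^sub>3
      = (x\<^sub>1 * y\<^sub>2 * (- y\<^sub>3) + x\<^sub>2 * y\<^sub>1 * (- y\<^sub>3) + x\<^sub>3 * y\<^sub>1 * y\<^sub>2) / (y\<^sub>1 * y\<^sub>2 * (- y\<^sub>3))"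
    using y(3,4) y3_nz by (simp add: add_divide_distrib diff_divide_distrib)
  also have "\<dots> = - (1 / \<nu> * chord_num \<alpha> * (1 / chord_den \<alpha>))"
    unfolding sum prod using \<nu> by (simp add: power2_eq_square power3_eq_cube)
  finally show "x\<^sub>3 / y\<^sub>3 = x\<^sub>1 / y\<^sub>1 + x\<^sub>2 / y\<^sub>2 + 1 / \<nu> * chord_num \<alpha> * (1 / chord_den \<alpha>)"
    by simp
  have "y\<^sub>3 = \<nu> * (\<alpha> * x\<^sub>3 - 1)"
    using y3 m_eq by algebra
  then have "\<alpha> * x\<^sub>3 = y\<^sub>3 / \<nu> + 1"
    using \<nu> by simp
  have "\<alpha> * (x\<^sub>3 / y\<^sub>3) = (\<alpha> * x\<^sub>3) / y\<^sub>3"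
    by simp
  also have "\<dots> = 1 / \<nu> + 1 / y\<^sub>3"
    using y3_nz \<open>\<alpha> * x\<^sub>3 = y\<^sub>3 / \<nu> + 1\<close> by (simp add: add_divide_distrib)
  finally show "1 / y\<^sub>3 = \<alpha> * (x\<^sub>3 / y\<^sub>3) - 1 / \<nu>"
    by simp
qed


text \<open>
  The numerator of the slope is a quadratic form, so slopes of lines through points of the kernel
  are divisible by \<open>p\<^sup>2\<close>.  This is where the factor \<open>p\<^sup>2\<close> in \<open>translation_isometry\<close> comes from.
\<close>

lemma slope_multiple:
  assumes "z\<^sub>1 = of_int p * s\<^sub>1" "w\<^sub>1 = of_int p * t\<^sub>1" "z\<^sub>2 = of_int p * s\<^sub>2" "w\<^sub>2 = of_int p * t\<^sub>2"
    and "s\<^sub>1 \<in> p_integral p" "t\<^sub>1 \<in> p_integral p" "s\<^sub>2 \<in> p_integral p" "t\<^sub>2 \<in> p_integral p"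
  shows "slope z\<^sub>1 w\<^sub>1 z\<^sub>2 w\<^sub>2
      = (of_int p)\<^sup>2 * (slope_num s\<^sub>1 t\<^sub>1 s\<^sub>2 * (1 / slope_den w\<^sub>1 z\<^sub>2 w\<^sub>2))"
proof -
  have "slope_num z\<^sub>1 w\<^sub>1 z\<^sub>2 = (of_int p)\<^sup>2 * slope_num s\<^sub>1 t\<^sub>1 s\<^sub>2"
    by (simp add: slope_num_def assms(1-4) algebra_simps power2_eq_square)
  then show ?thesis
    by (simp add: slope_def)
qed

lemma slope_num_integral:
  assumes "s\<^sub>1 \<in> p_integral p" "t\<^sub>1 \<in> p_integral p" "s\<^sub>2 \<in> p_integral p"
  shows "slope_num s\<^sub>1 t\<^sub>1 s\<^sub>2 \<in> p_integral p"
  unfolding slope_num_def using assms prime_p by (intro p_integral_intros coeff_integral)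

section \<open>Addition on the kernel of reduction\<close>

text \<open>
  The sum of the \<open>z\<close>-coordinates of the three points on a line is
  \<open>- \<beta> chord_num \<alpha> / chord_den \<alpha>\<close>, and reflection in the \<open>x\<close>-axis changes the sign of \<open>z\<close>.  Since the
  slope \<open>\<alpha>\<close> is written with a unit as denominator, a single formula covers all the
  cases of the addition law; if a summand is infinite or the points are opposite to each other, the
  line passes through the origin and \<open>\<beta> = 0\<close>.
\<close>

lemma point_add_kernel:
  assumes P: "P \<in> kernel" and Q: "Q \<in> kernel"
  defines "\<alpha> \<equiv> slope (local_z P) (local_w P) (local_z Q) (local_w Q)"
  defines "\<beta> \<equiv> local_w P - \<alpha> * local_z P"
  shows "point_add f Q P \<in> kernel"
    and "local_z (point_add f Q P)
      = local_z P + local_z Q + \<beta> * chord_num \<alpha> * (1 / chord_den \<alpha>)"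
proof -
  obtain s\<^sub>1 t\<^sub>1 where 1: "s\<^sub>1 \<in> p_integral p" "t\<^sub>1 \<in> p_integral p"
    "local_z P = of_int p * s\<^sub>1" "local_w P = of_int p * t\<^sub>1"
    using P by (rule kernelE)
  obtain s\<^sub>2 t\<^sub>2 where 2: "s\<^sub>2 \<in> p_integral p" "t\<^sub>2 \<in> p_integral p"
    "local_z Q = of_int p * s\<^sub>2" "local_w Q = of_int p * t\<^sub>2"
    using Q by (rule kernelE)
  define den where "den = slope_den (local_w P) (local_z Q) (local_w Q)"
  define num where "num = slope_num (local_z P) (local_w P) (local_z Q)"
  have den: "den \<noteq> 0" "1 / den \<in> p_integral p"
    unfolding den_def using 1 2 by (intro slope_den_unit; simp)+
  have \<alpha>_eq: "\<alpha> * den = num"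
    using den(1) by (simp add: \<alpha>_def slope_def den_def num_def)
  have "den * (local_w Q - local_w P) = num * (local_z Q - local_z P)"
    unfolding den_def num_def
    by (intro slope_eq local_equation[OF P refl refl] local_equation[OF Q refl refl])
  then have "den * (local_w Q - local_w P) = den * (\<alpha> * (local_z Q - local_z P))"
    by (simp add: \<alpha>_eq[symmetric])
  then have line: "local_w Q - local_w P = \<alpha> * (local_z Q - local_z P)"
    using den(1) by simp
  define r where "r = of_int p * (slope_num s\<^sub>1 t\<^sub>1 s\<^sub>2 * (1 / den))"
  have r: "r \<in> p_integral p"
    unfolding r_def using 1 2 den prime_p by (intro p_integral_intros slope_num_integral)
  have \<alpha>_r: "\<alpha> = of_int p * r"
    unfolding \<alpha>_def r_def den_def using slope_multiple[OF 1(3,4) 2(3,4) 1(1,2) 2(1,2)]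
    by (simp add: power2_eq_square)
  define b where "b = t\<^sub>1 - \<alpha> * s\<^sub>1"
  have b: "b \<in> p_integral p"
    unfolding b_def \<alpha>_r using 1 r prime_p by (intro p_integral_intros)
  have \<beta>_b: "\<beta> = of_int p * b"
    by (simp add: \<beta>_def b_def 1 algebra_simps)
  have cden: "chord_den \<alpha> \<noteq> 0" "1 / chord_den \<alpha> \<in> p_integral p"
    using chord_den_unit[OF \<alpha>_r r] by simp_all
  have cnum: "chord_num \<alpha> \<in> p_integral p"
    unfolding chord_num_def \<alpha>_r using r prime_p by (intro p_integral_intros coeff_integral)
  let ?z = "local_z P + local_z Q + \<beta> * chord_num \<alpha> * (1 / chord_den \<alpha>)"
  define u where "u = s\<^sub>1 + s\<^sub>2 + b * chord_num \<alpha> * (1 / chord_den \<alpha>)"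
  have u: "u \<in> p_integral p"
    unfolding u_def using 1 2 b cnum cden prime_p by (intro p_integral_intros)
  have z_u: "?z = of_int p * u"
    unfolding u_def \<beta>_b 1 2 by (simp add: algebra_simps)
  have "point_add f Q P \<in> kernel \<and> local_z (point_add f Q P) = ?z"
  proof (cases "P = Infinity \<or> Q = Infinity")
    case True
    then have "\<beta> = 0"
      using line by (auto simp: \<beta>_def)
    moreover have "point_add f Q Infinity = Q"
      by (cases Q) simp_all
    ultimately show ?thesis
      using True P Q by auto
  next
    case False
    then obtain x\<^sub>1 y\<^sub>1 x\<^sub>2 y\<^sub>2 where PQ: "P = Affine x\<^sub>1 y\<^sub>1" "Q = Affine x\<^sub>2 y\<^sub>2"
      using point.exhaust by metis
    have c: "y\<^sub>1 \<noteq> 0" "y\<^sub>2 \<noteq> 0" "y\<^sub>1\<^sup>2 = poly f x\<^sub>1" "y\<^sub>2\<^sup>2 = poly f x\<^sub>2"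
      using P Q PQ by (auto simp: kernel_def)
    have line': "1 / y\<^sub>2 - 1 / y\<^sub>1 = \<alpha> * (x\<^sub>2 / y\<^sub>2 - x\<^sub>1 / y\<^sub>1)"
      using line by (simp add: PQ)
    have "(1 / y\<^sub>2 - 1 / y\<^sub>1) * (y\<^sub>1 * y\<^sub>2) = y\<^sub>1 - y\<^sub>2"
      using c by (simp add: field_simps)
    moreover have "(x\<^sub>2 / y\<^sub>2 - x\<^sub>1 / y\<^sub>1) * (y\<^sub>1 * y\<^sub>2) = x\<^sub>2 * y\<^sub>1 - x\<^sub>1 * y\<^sub>2"
      using c by (simp add: field_simps)
    ultimately have line'': "y\<^sub>1 - y\<^sub>2 = \<alpha> * (x\<^sub>2 * y\<^sub>1 - x\<^sub>1 * y\<^sub>2)"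
      using line' by (metis mult.assoc)
    show ?thesis
    proof (cases "x\<^sub>2 = x\<^sub>1 \<and> y\<^sub>2 = - y\<^sub>1")
      case True
      then have "2 * y\<^sub>1 = 2 * (\<alpha> * x\<^sub>1 * y\<^sub>1)"
        using line'' by (simp add: algebra_simps)
      then have "\<alpha> * x\<^sub>1 = 1"
        using c by simp
      then have "\<beta> = 0"
        by (simp add: \<beta>_def PQ)
      then show ?thesis
        using True by (simp add: PQ kernel_def)
    next
      case not_opp: False
      define m where
        "m = (if x\<^sub>2 = x\<^sub>1 then poly (pderiv f) x\<^sub>2 / (2 * y\<^sub>2) else (y\<^sub>1 - y\<^sub>2) / (x\<^sub>1 - x\<^sub>2))"
      define \<nu> where "\<nu> = y\<^sub>2 - m * x\<^sub>2"
      define x\<^sub>3 where "x\<^sub>3 = m\<^sup>2 - a2 - x\<^sub>2 - x\<^sub>1"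
      define y\<^sub>3 where "y\<^sub>3 = m * (x\<^sub>2 - x\<^sub>3) - y\<^sub>2"
      have add: "point_add f Q P = Affine x\<^sub>3 y\<^sub>3"
        unfolding PQ point_add.simps Let_def x\<^sub>3_def y\<^sub>3_def m_def using not_opp by simp
      have curves: "y\<^sub>1\<^sup>2 = x\<^sub>1 ^ 3 + a2 * x\<^sub>1\<^sup>2 + a4 * x\<^sub>1 + a6"
          "y\<^sub>2\<^sup>2 = x\<^sub>2 ^ 3 + a2 * x\<^sub>2\<^sup>2 + a4 * x\<^sub>2 + a6"
        using c by (simp_all add: poly_f)
      have "y\<^sub>1 = m * x\<^sub>1 + \<nu> \<and> \<nu> \<noteq> 0 \<and> m = - \<alpha> * \<nu> \<and>
        x\<^sub>2\<^sup>2 + x\<^sub>2 * x\<^sub>1 + x\<^sub>1\<^sup>2 + (a2 - m\<^sup>2) * (x\<^sub>2 + x\<^sub>1) + (a4 - 2 * m * \<nu>) = 0"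
      proof (cases "x\<^sub>2 = x\<^sub>1")
        case True
        have "y\<^sub>2\<^sup>2 = y\<^sub>1\<^sup>2"
          using c True by simp
        then have y: "y\<^sub>2 = y\<^sub>1"
          using True not_opp by (simp add: power2_eq_iff)
        have m: "2 * m * y\<^sub>1 = 3 * x\<^sub>1\<^sup>2 + 2 * a2 * x\<^sub>1 + a4"
          using True c y by (simp add: m_def poly_pderiv_f)
        have yw: "y\<^sub>1 * local_w P = 1" "local_z P = x\<^sub>1 * local_w P"
          using c by (simp_all add: PQ)
        have same: "local_z Q = local_z P" "local_w Q = local_w P"
          using True y by (simp_all add: PQ)
        \<comment> \<open>Clearing \<open>w = 1 / y\<close> from the slope turns it into the tangent data \<open>- m / \<nu>\<close>.\<close>
        have den_y: "den * y\<^sub>1\<^sup>2 = y\<^sub>1\<^sup>2 - a2 * x\<^sub>1\<^sup>2 - 2 * a4 * x\<^sub>1 - 3 * a6"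
          unfolding den_def slope_den_def same using yw by algebra
        have num_y: "num * y\<^sub>1\<^sup>2 = 3 * x\<^sub>1\<^sup>2 + 2 * a2 * x\<^sub>1 + a4"
          unfolding num_def slope_num_def same using yw by algebra
        have "2 * y\<^sub>1 * \<nu> = - den * y\<^sub>1\<^sup>2"
          using den_y m curves(1) unfolding \<nu>_def True y by algebra
        then have "y\<^sub>1 * (2 * \<nu>) = y\<^sub>1 * (- den * y\<^sub>1)"
          by (simp add: power2_eq_square algebra_simps)
        then have \<nu>: "2 * \<nu> = - den * y\<^sub>1"
          using c(1) by (metis mult_left_cancel)
        have "y\<^sub>1 * (2 * m) = y\<^sub>1 * (num * y\<^sub>1)"
          using m num_y by (simp add: power2_eq_square algebra_simps)
        then have "2 * m = num * y\<^sub>1"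
          using c(1) by (metis mult_left_cancel)
        then have "2 * m = 2 * (- \<alpha> * \<nu>)"
          using \<nu> \<alpha>_eq by algebra
        moreover have "\<nu> \<noteq> 0"
          using \<nu> den(1) c(1) by auto
        moreover have "x\<^sub>1\<^sup>2 + x\<^sub>1 * x\<^sub>1 + x\<^sub>1\<^sup>2 + (a2 - m\<^sup>2) * (x\<^sub>1 + x\<^sub>1) + (a4 - 2 * m * \<nu>) = 0"
          using m unfolding \<nu>_def True y by algebra
        ultimately show ?thesis
          using True y by (simp add: \<nu>_def)
      next
        case neq: False
        have m: "m * (x\<^sub>1 - x\<^sub>2) = y\<^sub>1 - y\<^sub>2"
          using neq by (simp add: m_def)
        have "P \<noteq> Q"
          using neq by (simp add: PQ)
        then have z_neq: "x\<^sub>1 / y\<^sub>1 \<noteq> x\<^sub>2 / y\<^sub>2"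
          using local_z_inj[OF P Q] by (auto simp: PQ)
        have \<nu>: "\<nu> * (x\<^sub>1 - x\<^sub>2) = x\<^sub>1 * y\<^sub>2 - x\<^sub>2 * y\<^sub>1"
          using m unfolding \<nu>_def by algebra
        moreover have "x\<^sub>1 * y\<^sub>2 - x\<^sub>2 * y\<^sub>1 \<noteq> 0"
          using z_neq c by (simp add: frac_eq_eq)
        ultimately have "\<nu> \<noteq> 0"
          by auto
        moreover have "m * (x\<^sub>1 - x\<^sub>2) = (- \<alpha> * \<nu>) * (x\<^sub>1 - x\<^sub>2)"
          using m line'' \<nu> by algebra
        then have "m = - \<alpha> * \<nu>"
          using neq by (subst (asm) mult_right_cancel) simp_all
        moreover have "(x\<^sub>1 - x\<^sub>2) *
          (x\<^sub>2\<^sup>2 + x\<^sub>2 * x\<^sub>1 + x\<^sub>1\<^sup>2 + (a2 - m\<^sup>2) * (x\<^sub>2 + x\<^sub>1) + (a4 - 2 * m * \<nu>)) = 0"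
          using m curves unfolding \<nu>_def by algebra
        then have "x\<^sub>2\<^sup>2 + x\<^sub>2 * x\<^sub>1 + x\<^sub>1\<^sup>2 + (a2 - m\<^sup>2) * (x\<^sub>2 + x\<^sub>1) + (a4 - 2 * m * \<nu>) = 0"
          using neq by simp
        moreover have "y\<^sub>1 = m * x\<^sub>1 + \<nu>"
          using m unfolding \<nu>_def by algebra
        ultimately show ?thesis
          by blast
      qed
      then have y1: "y\<^sub>1 = m * x\<^sub>1 + \<nu>" and \<nu>: "\<nu> \<noteq> 0" and m_eq: "m = - \<alpha> * \<nu>"
        and double:
          "x\<^sub>2\<^sup>2 + x\<^sub>2 * x\<^sub>1 + x\<^sub>1\<^sup>2 + (a2 - m\<^sup>2) * (x\<^sub>2 + x\<^sub>1) + (a4 - 2 * m * \<nu>) = 0"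
        by blast+
      have y2: "y\<^sub>2 = m * x\<^sub>2 + \<nu>"
        by (simp add: \<nu>_def)
      have \<alpha>_m: "- m / \<nu> = \<alpha>"
        using \<nu> by (simp add: m_eq)
      have "\<beta> * \<nu> * y\<^sub>1 = y\<^sub>1"
        using y1 m_eq c(1) by (simp add: \<beta>_def PQ algebra_simps)
      then have \<beta>_\<nu>: "1 / \<nu> = \<beta>"
        using c(1) \<nu> by (simp add: field_simps)
      have cden': "chord_den (- m / \<nu>) \<noteq> 0"
        unfolding \<alpha>_m by (rule cden(1))
      note third = third_intersection[OF y2 y1 c(2,1,4) double \<nu> cden',
        folded x\<^sub>3_def, folded y\<^sub>3_def, unfolded \<alpha>_m \<beta>_\<nu>]
      have z3: "x\<^sub>3 / y\<^sub>3 = ?z"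
        using third(3) by (simp add: PQ)
      have "1 / y\<^sub>3 = of_int p * (r * (of_int p * u) - b)"
        unfolding third(4) z3 z_u by (simp add: \<alpha>_r \<beta>_b algebra_simps)
      moreover have "r * (of_int p * u) - b \<in> p_integral p"
        using r u b prime_p by (intro p_integral_intros)
      ultimately show ?thesis
        using z3 z_u u third(1,2) by (auto simp: add kernel_def)
    qed
  qed
  then show "point_add f Q P \<in> kernel" "local_z (point_add f Q P) = ?z"
    by blast+
qed


text \<open>
  By the addition formula \<open>z (Q + P)\<close> equals \<open>z P + z Q + p B\<close>, where \<open>B\<close> depends on \<open>Q\<close> only
  through the slope \<open>\<alpha>\<close>.  The slope is \<open>p\<^sup>2\<close> times a function \<open>A\<close> that respects congruence modulo
  \<open>e\<close>, the difference of the parameters \<open>z / p\<close> of \<open>Q\<close> and \<open>Q'\<close>.  Hence both \<open>\<alpha>\<close> and \<open>B\<close> change by a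
  multiple of \<open>p\<^sup>2 e\<close> when \<open>Q\<close> is replaced by \<open>Q'\<close>.
\<close>

lemma translation_isometry:
  assumes P: "P \<in> kernel" and Q: "Q \<in> kernel" and Q': "Q' \<in> kernel"
  obtains s where "s \<in> p_integral p"
    "local_z (point_add f Q P) - local_z (point_add f Q' P)
      = (local_z Q - local_z Q') * (1 + (of_int p)\<^sup>2 * s)"
proof -
  obtain s\<^sub>1 t\<^sub>1 where 1: "s\<^sub>1 \<in> p_integral p" "t\<^sub>1 \<in> p_integral p"
    "local_z P = of_int p * s\<^sub>1" "local_w P = of_int p * t\<^sub>1"
    using P by (rule kernelE)
  obtain s\<^sub>2 t\<^sub>2 where 2: "s\<^sub>2 \<in> p_integral p" "t\<^sub>2 \<in> p_integral p"
    "local_z Q = of_int p * s\<^sub>2" "local_w Q = of_int p * t\<^sub>2"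
    using Q by (rule kernelE)
  obtain s\<^sub>3 t\<^sub>3 where 3: "s\<^sub>3 \<in> p_integral p" "t\<^sub>3 \<in> p_integral p"
    "local_z Q' = of_int p * s\<^sub>3" "local_w Q' = of_int p * t\<^sub>3"
    using Q' by (rule kernelE)
  have p0: "of_int p \<noteq> (0 :: rat)"
    using prime_p by auto
  define e where "e = s\<^sub>2 - s\<^sub>3"
  define k where "k = (of_int p :: rat)\<^sup>2"
  have k: "k \<in> p_integral p"
    unfolding k_def using prime_p by (intro p_integral_intros)
  note refls = p_cong_refl[OF prime_p]
  have cong_s: "p_cong p e s\<^sub>2 s\<^sub>3"
    using 2 3 prime_p by (intro p_congI[of _ _ _ 1] p_integral_one) (simp_all add: e_def)
  have cong_t: "p_cong p e t\<^sub>2 t\<^sub>3"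
  proof -
    let ?\<mu> = "slope (local_z Q') (local_w Q') (local_z Q) (local_w Q)"
    have den: "slope_den (local_w Q') (local_z Q) (local_w Q) \<noteq> 0"
      "1 / slope_den (local_w Q') (local_z Q) (local_w Q) \<in> p_integral p"
      using 2 3 by (intro slope_den_unit; simp)+
    have "local_w Q - local_w Q' = ?\<mu> * (local_z Q - local_z Q')"
      using slope_eq[OF local_equation[OF Q' refl refl] local_equation[OF Q refl refl]] den(1)
      by (simp add: slope_def nonzero_eq_divide_eq mult.commute)
    then have "of_int p * (t\<^sub>2 - t\<^sub>3) = of_int p * (e * ?\<mu>)"
      by (simp add: 2 3 e_def algebra_simps)
    then have "t\<^sub>2 - t\<^sub>3 = e * ?\<mu>"
      using p0 by (metis mult_left_cancel)
    moreover have "?\<mu> \<in> p_integral p"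
      unfolding slope_multiple[OF 3(3,4) 2(3,4) 3(1,2) 2(1,2)]
      using 2 3 den prime_p by (intro p_integral_intros slope_num_integral)
    ultimately show ?thesis
      using 2 3 by (intro p_congI)
  qed
  define A where "A s t = slope_num s\<^sub>1 t\<^sub>1 s
    * (1 / slope_den (of_int p * t\<^sub>1) (of_int p * s) (of_int p * t))" for s t
  define \<alpha> where "\<alpha> s t = k * A s t" for s t
  define B where "B s t = (t\<^sub>1 - \<alpha> s t * s\<^sub>1) * chord_num (\<alpha> s t) * (1 / chord_den (\<alpha> s t))" for s t
  have den: "slope_den (of_int p * t\<^sub>1) (of_int p * s) (of_int p * t) \<noteq> 0"
    "1 / slope_den (of_int p * t\<^sub>1) (of_int p * s) (of_int p * t) \<in> p_integral p"
    if "s \<in> p_integral p" "t \<in> p_integral p" for s t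
    using that 1 by (intro slope_den_unit[OF refl refl refl]; simp)+
  have A_int: "A s t \<in> p_integral p" if "s \<in> p_integral p" "t \<in> p_integral p" for s t
    unfolding A_def using that 1 den prime_p by (intro p_integral_intros slope_num_integral)
  have cden: "chord_den (\<alpha> s t) \<noteq> 0" "1 / chord_den (\<alpha> s t) \<in> p_integral p"
    if "s \<in> p_integral p" "t \<in> p_integral p" for s t
  proof -
    have "\<alpha> s t = of_int p * (of_int p * A s t)"
      by (simp add: \<alpha>_def k_def power2_eq_square)
    moreover have "of_int p * A s t \<in> p_integral p"
      using A_int[OF that] prime_p by (intro p_integral_intros)
    ultimately show "chord_den (\<alpha> s t) \<noteq> 0" "1 / chord_den (\<alpha> s t) \<in> p_integral p"
      by (rule chord_den_unit)+
  qed
  have z_add: "local_z (point_add f R P) = of_int p * s\<^sub>1 + of_int p * s + of_int p * B s t"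
    if "R \<in> kernel" "local_z R = of_int p * s" "local_w R = of_int p * t"
      "s \<in> p_integral p" "t \<in> p_integral p" for R s t
  proof -
    have sl: "slope (local_z P) (local_w P) (local_z R) (local_w R) = \<alpha> s t"
      unfolding slope_multiple[OF 1(3,4) that(2,3) 1(1,2) that(4,5)]
      unfolding \<alpha>_def A_def k_def 1(4) that(2,3) ..
    show ?thesis
      using point_add_kernel(2)[OF P that(1), unfolded sl] unfolding B_def 1(3,4) that(2)
      by (simp add: algebra_simps)
  qed
  have "p_cong p e (slope_den (of_int p * t\<^sub>1) (of_int p * s\<^sub>2) (of_int p * t\<^sub>2))
      (slope_den (of_int p * t\<^sub>1) (of_int p * s\<^sub>3) (of_int p * t\<^sub>3))"
    unfolding slope_den_def
    by (intro p_cong_intros prime_p cong_s cong_t refls p_integral_intros coeff_integral 1)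
  then have cong_A: "p_cong p e (A s\<^sub>2 t\<^sub>2) (A s\<^sub>3 t\<^sub>3)"
    unfolding A_def slope_num_def
    by (intro p_cong_intros p_cong_inverse den prime_p cong_s refls p_integral_intros
        coeff_integral 1 2 3)
  have cong_\<alpha>: "p_cong p (k * e) (\<alpha> s\<^sub>2 t\<^sub>2) (\<alpha> s\<^sub>3 t\<^sub>3)"
    unfolding \<alpha>_def by (intro p_cong_scale prime_p cong_A k)
  have "p_cong p (k * e) (chord_den (\<alpha> s\<^sub>2 t\<^sub>2)) (chord_den (\<alpha> s\<^sub>3 t\<^sub>3))"
    unfolding chord_den_def
    by (intro p_cong_intros prime_p cong_\<alpha> refls p_integral_intros coeff_integral)
  then have "p_cong p (k * e) (B s\<^sub>2 t\<^sub>2) (B s\<^sub>3 t\<^sub>3)"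
    unfolding B_def chord_num_def
    by (intro p_cong_intros p_cong_inverse cden prime_p cong_\<alpha> refls p_integral_intros
        coeff_integral 1 2 3)
  then obtain s where s: "s \<in> p_integral p" "B s\<^sub>2 t\<^sub>2 - B s\<^sub>3 t\<^sub>3 = k * e * s"
    by (rule p_congE)
  have "local_z (point_add f Q P) - local_z (point_add f Q' P)
      = of_int p * e + of_int p * (B s\<^sub>2 t\<^sub>2 - B s\<^sub>3 t\<^sub>3)"
    using z_add[OF Q 2(3,4,1,2)] z_add[OF Q' 3(3,4,1,2)] by (simp add: e_def algebra_simps)
  also have "\<dots> = (local_z Q - local_z Q') * (1 + (of_int p)\<^sup>2 * s)"
    unfolding s(2) by (simp add: 2 3 e_def k_def algebra_simps)
  finally show thesis
    using s(1) that by blast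
qed

section \<open>Points in the kernel of reduction have infinite order\<close>

abbreviation multiple :: "point \<Rightarrow> nat \<Rightarrow> point" where
  "multiple P n \<equiv> P [^]\<^bsub>rational_points f\<^esub> n"

lemma one_rational_points [simp]: "\<one>\<^bsub>rational_points f\<^esub> = Infinity"
  by (simp add: rational_points_def)

lemma multiple_0: "multiple P 0 = Infinity"
  by simp

lemma multiple_Suc: "multiple P (Suc n) = point_add f (multiple P n) P"
  by (simp add: nat_pow_def rational_points_def)

lemma multiple_kernel:
  assumes "P \<in> kernel"
  shows "multiple P n \<in> kernel"
proof (induction n)
  case 0
  show ?case
    by (simp add: multiple_0 kernel_def)
next
  case (Suc n)
  then show ?case
    unfolding multiple_Suc using assms by (intro point_add_kernel(1))
qed

text \<open>
  Passing from the pair \<open>m P\<close>, \<open>0\<close> to the pair \<open>(m + j) P\<close>, \<open>j P\<close> takes \<open>j\<close> translations by \<open>P\<close>, since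
  multiples are formed by adding \<open>P\<close> repeatedly; each translation contributes a factor congruent
  to 1.
\<close>

lemma local_z_shift:
  assumes "P \<in> kernel"
  shows "\<exists>s \<in> p_integral p. local_z (multiple P (m + j)) - local_z (multiple P j)
    = local_z (multiple P m) * (1 + (of_int p)\<^sup>2 * s)"
proof (induction j)
  case 0
  show ?case
    using p_integral_zero[OF prime_p] by (intro bexI[of _ 0]) (simp_all add: multiple_0)
next
  case (Suc j)
  then obtain s where s: "s \<in> p_integral p"
    "local_z (multiple P (m + j)) - local_z (multiple P j)
      = local_z (multiple P m) * (1 + (of_int p)\<^sup>2 * s)"
    by blast
  obtain s' where s': "s' \<in> p_integral p"
    "local_z (point_add f (multiple P (m + j)) P) - local_z (point_add f (multiple P j) P)
      = (local_z (multiple P (m + j)) - local_z (multiple P j)) * (1 + (of_int p)\<^sup>2 * s')"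
    using translation_isometry[OF assms multiple_kernel[OF assms] multiple_kernel[OF assms]]
    by blast
  let ?s = "s + s' + (of_int p)\<^sup>2 * s * s'"
  have "local_z (multiple P (m + Suc j)) - local_z (multiple P (Suc j))
      = local_z (multiple P m) * (1 + (of_int p)\<^sup>2 * s) * (1 + (of_int p)\<^sup>2 * s')"
    using s(2) s'(2) unfolding add_Suc_right multiple_Suc by simp
  also have "\<dots> = local_z (multiple P m) * (1 + (of_int p)\<^sup>2 * ?s)"
    by (simp add: algebra_simps)
  finally show ?case
    using s(1) s'(1) prime_p by (intro bexI[of _ ?s] p_integral_intros)
qed

lemma local_z_mult:
  assumes "P \<in> kernel"
  shows "\<exists>s \<in> p_integral p. local_z (multiple P (q * m))
    = local_z (multiple P m) * (of_nat q + (of_int p)\<^sup>2 * s)"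
proof (induction q)
  case 0
  show ?case
    using p_integral_zero[OF prime_p] by (intro bexI[of _ 0]) (simp_all add: multiple_0)
next
  case (Suc q)
  then obtain s where s: "s \<in> p_integral p"
    "local_z (multiple P (q * m)) = local_z (multiple P m) * (of_nat q + (of_int p)\<^sup>2 * s)"
    by blast
  obtain s' where s': "s' \<in> p_integral p"
    "local_z (multiple P (m + q * m)) - local_z (multiple P (q * m))
      = local_z (multiple P m) * (1 + (of_int p)\<^sup>2 * s')"
    using local_z_shift[OF assms] by blast
  have "local_z (multiple P (Suc q * m))
      = local_z (multiple P (q * m)) + local_z (multiple P m) * (1 + (of_int p)\<^sup>2 * s')"
    using s'(2) by (simp add: algebra_simps)
  also have "\<dots> = local_z (multiple P m) * (of_nat (Suc q) + (of_int p)\<^sup>2 * (s + s'))"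
    unfolding s(2) by (simp add: algebra_simps)
  finally show ?case
    using s(1) s'(1) prime_p by (intro bexI[of _ "s + s'"] p_integral_intros)
qed

text \<open>
  The previous lemma decides only factors \<open>q\<close> not divisible by \<open>p\<^sup>2\<close>, so powers of \<open>p\<close> are split off
  one at a time: if \<open>p\<close> divides \<open>n\<close>, the step from \<open>n / p\<close> to \<open>n\<close> multiplies \<open>z\<close> by
  \<open>p + p\<^sup>2 s \<noteq> 0\<close>; otherwise the step from 1 to \<open>n\<close> multiplies it by a unit.
\<close>

lemma local_z_multiple_nonzero:
  assumes "P \<in> kernel" "P \<noteq> Infinity" "n > 0"
  shows "local_z (multiple P n) \<noteq> 0"
  using assms(3)
proof (induction n rule: less_induct)
  case (less n)
  have p: "p > 1"
    using prime_p by (rule prime_gt_1_int)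
  show ?case
  proof (cases "p dvd int n")
    case True
    then have "nat p dvd n"
      using p by (simp add: nat_dvd_iff)
    then obtain m where m: "n = nat p * m" ..
    have "m > 0" "m < n"
      using m less.prems p by (auto intro: gr0I)
    then have "local_z (multiple P m) \<noteq> 0"
      by (intro less.IH)
    moreover obtain s where s: "s \<in> p_integral p" "local_z (multiple P n)
        = local_z (multiple P m) * (of_nat (nat p) + (of_int p)\<^sup>2 * s)"
      using local_z_mult[OF assms(1), of "nat p" m] m by blast
    have "of_nat (nat p) + (of_int p)\<^sup>2 * s = of_int p * (1 + of_int p * s)"
      using p by (simp add: algebra_simps power2_eq_square)
    moreover have "of_int p * (1 + of_int p * s) \<noteq> 0"
      using one_plus_p_mult(1)[OF s(1)] p by simp
    ultimately show ?thesis
      using s(2) by simp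
  next
    case False
    obtain s where s: "s \<in> p_integral p" "local_z (multiple P n)
        = local_z (multiple P 1) * (of_nat n + (of_int p)\<^sup>2 * s)"
      using local_z_mult[OF assms(1), of n 1] by auto
    have "local_z P \<noteq> local_z Infinity"
      using local_z_inj[of P Infinity] assms by (auto simp: kernel_def)
    moreover have "multiple P 1 = P"
      unfolding One_nat_def multiple_Suc multiple_0 by simp
    moreover have "of_int p * s \<in> p_integral p"
      using s(1) prime_p by (intro p_integral_intros)
    then have "of_int (int n) + of_int p * (of_int p * s) \<noteq> 0"
      using False prime_p by (intro p_unit(1))
    then have "of_nat n + (of_int p)\<^sup>2 * s \<noteq> 0"
      by (simp add: power2_eq_square mult.assoc)
    ultimately show ?thesis
      using s(2) by simp
  qed
qed

text \<open>
  For non-integral \<open>x\<close> the term \<open>x\<^sup>3\<close> dominates \<open>f(x)\<close>, so that \<open>y\<^sup>2\<close> is \<open>x\<^sup>3\<close> times a unit and \<open>(x / y)\<^sup>2\<close> is \<open>1 / x\<close>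
  times a unit: the point lies in the kernel of reduction.
\<close>

theorem positive_rank_if_nonintegral_point:
  assumes curve: "y\<^sup>2 = poly f x" and x: "x \<notin> p_integral p"
  shows "positive_rank f"
proof -
  obtain s where s: "s \<in> p_integral p" "1 / x = of_int p * s"
    using inverse_not_p_integral[OF prime_p x] .
  have x0: "x \<noteq> 0"
    using x p_integral_zero[OF prime_p] by auto
  define u where "u = s * (a2 + a4 * (of_int p * s) + a6 * (of_int p * s)\<^sup>2)"
  have u: "u \<in> p_integral p"
    unfolding u_def using s(1) prime_p by (intro p_integral_intros coeff_integral)
  have x_inv: "x * (of_int p * s) = 1"
    using s(2) x0 by (metis nonzero_eq_divide_eq mult.commute)
  have y2: "y\<^sup>2 = x ^ 3 * (1 + of_int p * u)"
    unfolding curve poly_f u_def using x_inv by algebra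
  then have y0: "y \<noteq> 0"
    using x0 one_plus_p_mult(1)[OF u] by auto
  have "(x / y)\<^sup>2 = x\<^sup>2 / (x ^ 3 * (1 + of_int p * u))"
    unfolding power_divide y2 ..
  also have "\<dots> = 1 / x * (1 / (1 + of_int p * u))"
    using x0 by (simp add: power2_eq_square power3_eq_cube)
  also have "\<dots> = of_int p * (s * (1 / (1 + of_int p * u)))"
    unfolding s(2) by (simp only: mult.assoc)
  finally obtain r where r: "r \<in> p_integral p" "x / y = of_int p * r"
    using p_divides_if_p_divides_square[OF prime_p] s(1) u one_plus_p_mult(2)
      p_integral_mult[OF prime_p] by metis
  have "1 / y = (x / y) * (1 / x)"
    using x0 by simp
  also have "\<dots> = of_int p * (of_int p * (r * s))"
    unfolding r(2) s(2) by (simp add: algebra_simps)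
  finally have w: "1 / y = of_int p * (of_int p * (r * s))" .
  moreover have "of_int p * (r * s) \<in> p_integral p"
    using r(1) s(1) prime_p by (intro p_integral_intros)
  ultimately have "Affine x y \<in> kernel"
    using y0 curve r by (auto simp: kernel_def)
  then have nonzero: "local_z (multiple (Affine x y) n) \<noteq> 0" if "n > 0" for n
    using that by (intro local_z_multiple_nonzero) simp_all
  have "multiple (Affine x y) n \<noteq> \<one>\<^bsub>rational_points f\<^esub>" if "n > 0" for n
  proof
    assume "multiple (Affine x y) n = \<one>\<^bsub>rational_points f\<^esub>"
    then have "local_z (multiple (Affine x y) n) = 0"
      by (simp only: one_rational_points local_z.simps)
    then show False
      using nonzero[OF that] by contradiction
  qed
  moreover have "Affine x y \<in> carrier (rational_points f)"
    using curve by (simp add: rational_points_def)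
  ultimately show ?thesis
    unfolding positive_rank_def by blast
qed

end

section \<open>A point with 3 in its denominator\<close>

lemma p_integral_cubic_E_curve:
  assumes "prime p"
  shows "p_integral_cubic (E_curve a b) p"
proof
  have f: "E_curve a b = [:0, of_nat a ^ 4 * of_nat b ^ 4, of_nat a ^ 4 + of_nat b ^ 4, 1:]"
    by (simp add: E_curve_def)
  show "prime p" by fact
  show "degree (E_curve a b) = 3" "lead_coeff (E_curve a b) = 1"
    by (simp_all add: f)
  fix i
  have "of_nat k \<in> p_integral p" for k
    using p_integral_of_int[OF assms, of "int k"] by simp
  then show "coeff (E_curve a b) i \<in> p_integral p"
    unfolding f coeff_pCons using assms
    by (auto split: nat.split intro!: p_integral_intros)
qed

lemma square_mod_3: "(x::int)\<^sup>2 mod 3 = (if 3 dvd x then 0 else 1)"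
proof -
  have "x mod 3 = 0 \<or> x mod 3 = 1 \<or> x mod 3 = 2"
    by presburger
  then show ?thesis
    unfolding dvd_eq_mod_eq_0 power_mod[of x 3 2, symmetric] by (elim disjE) simp_all
qed

lemma three_dvd_leg:
  assumes "(a::int)\<^sup>2 + b\<^sup>2 = c\<^sup>2"
  shows "3 dvd a \<or> 3 dvd b"
proof (rule ccontr)
  assume "\<not> (3 dvd a \<or> 3 dvd b)"
  then have "a\<^sup>2 mod 3 = 1" "b\<^sup>2 mod 3 = 1"
    by (simp_all add: square_mod_3)
  moreover have "c\<^sup>2 mod 3 = (a\<^sup>2 mod 3 + b\<^sup>2 mod 3) mod 3"
    unfolding assms[symmetric] by (simp only: mod_add_eq)
  ultimately have "c\<^sup>2 mod 3 = 2"
    by simp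
  then show False
    by (simp add: square_mod_3 split: if_splits)
qed

text \<open>
  The point is \<open>2 P + R\<close> for \<open>P = (a b\<^sup>3, a b\<^sup>3 (a + b) d)\<close> and \<open>R = (a\<^sup>2 b\<^sup>2, \<plusminus> a\<^sup>2 b\<^sup>2 c\<^sup>2)\<close>, where
  \<open>x(2 P) = (a b (a - b) / (2 d))\<^sup>2\<close>.  Because \<open>a\<^sup>2 b\<^sup>2\<close>, \<open>a\<^sup>2 b\<^sup>2 + a\<^sup>4 = (a c)\<^sup>2\<close> and
  \<open>a\<^sup>2 b\<^sup>2 + b\<^sup>4 = (b c)\<^sup>2\<close> are squares, \<open>R\<close> is a double and so is \<open>2 P + R\<close>.  Therefore \<open>x\<close>,
  \<open>x + a\<^sup>4\<close> and \<open>x + b\<^sup>4\<close> are all squares at that point, namely those of \<open>N / D\<close>, \<open>S / D\<close> and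
  \<open>T / D\<close> in the notation of the proof.
\<close>

lemma positive_rank_E_curve:
  fixes a b c d :: int
  assumes pyth: "a\<^sup>2 + b\<^sup>2 = c\<^sup>2" and side: "a\<^sup>2 - a * b + b\<^sup>2 = d\<^sup>2"
    and cop: "coprime a b" and nz: "a \<noteq> 0" "b \<noteq> 0"
  shows "positive_rank (E_curve (nat \<bar>a\<bar>) (nat \<bar>b\<bar>))"
proof -
  define u where "u = 2 * a\<^sup>2 - a * b + b\<^sup>2"
  define v where "v = a\<^sup>2 - a * b + 2 * b\<^sup>2"
  define D where "D = 3 * c\<^sup>2 - 2 * a * b"
  define N where "N e = u * v - 2 * c\<^sup>2 * (a - b) * e" for e
  have ab: "3 dvd a \<or> 3 dvd b"
    using pyth by (rule three_dvd_leg)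
  then have "3 dvd a * b"
    by (elim disjE) simp_all
  then have "3 dvd 3 * c\<^sup>2 - 2 * (a * b)"
    by (rule dvd_diff[OF dvd_triv_left dvd_mult])
  then have D3: "3 dvd D"
    by (simp only: D_def mult.assoc)
  have "D = 2 * a\<^sup>2 + 2 * b\<^sup>2 + (a - b)\<^sup>2"
    unfolding D_def using pyth by algebra
  moreover have "0 < a\<^sup>2" "0 \<le> b\<^sup>2" "0 \<le> (a - b)\<^sup>2"
    using nz by simp_all
  ultimately have D0: "D \<noteq> 0"
    by linarith
  \<comment> \<open>The sum \<open>N d + N (- d) = 2 u v\<close> is prime to 3, as 3 divides exactly one of \<open>a\<close> and \<open>b\<close>.\<close>
  have not_both: "\<not> (3 dvd N d \<and> 3 dvd N (- d))"
  proof
    assume "3 dvd N d \<and> 3 dvd N (- d)"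
    then have "3 dvd N d + N (- d)"
      by (intro dvd_add) simp_all
    moreover have "N d + N (- d) = 4 * (a ^ 4 + b ^ 4) + 3 * (- 2 * a * b * (a - b)\<^sup>2)"
      unfolding N_def u_def v_def by algebra
    ultimately have "3 dvd 4 * (a ^ 4 + b ^ 4)"
      by (simp only: dvd_add_left_iff[OF dvd_triv_left])
    moreover have p3: "prime (3::int)"
      by simp
    moreover have "\<not> (3::int) dvd 4"
      by simp
    ultimately have sum: "3 dvd a ^ 4 + b ^ 4"
      using prime_dvd_mult_iff by blast
    from ab have "3 dvd a \<and> 3 dvd b"
    proof
      assume a: "3 dvd a"
      then have "3 dvd a ^ 4"
        by (simp add: prime_dvd_power_iff)
      then have "3 dvd b ^ 4"
        using sum by (simp only: dvd_add_right_iff)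
      then show ?thesis
        using a prime_dvd_power[OF p3] by blast
    next
      assume b: "3 dvd b"
      then have "3 dvd b ^ 4"
        by (simp add: prime_dvd_power_iff)
      then have "3 dvd a ^ 4"
        using sum by (simp only: dvd_add_left_iff)
      then show ?thesis
        using b prime_dvd_power[OF p3] by blast
    qed
    then have "is_unit (3::int)"
      using cop by (meson coprime_common_divisor)
    then show False
      by simp
  qed
  obtain e where e: "e\<^sup>2 = d\<^sup>2" "\<not> 3 dvd N e"
    using not_both by (metis power2_minus)
  define S where "S = c * (2 * u * e - v * (a - b))"
  define T where "T = c * (2 * v * e - u * (a - b))"
  have side': "a\<^sup>2 - a * b + b\<^sup>2 = e\<^sup>2"
    using side e(1) by simp
  have S: "(N e)\<^sup>2 + a ^ 4 * D\<^sup>2 = S\<^sup>2"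
  proof -
    have "(u * v)\<^sup>2 + 4 * (c\<^sup>2)\<^sup>2 * (a - b)\<^sup>2 * e\<^sup>2 + a ^ 4 * D\<^sup>2
        = c\<^sup>2 * (4 * u\<^sup>2 * e\<^sup>2 + v\<^sup>2 * (a - b)\<^sup>2)"
      unfolding u_def v_def D_def pyth[symmetric] side'[symmetric] by algebra
    then show ?thesis
      unfolding N_def S_def by algebra
  qed
  have T: "(N e)\<^sup>2 + b ^ 4 * D\<^sup>2 = T\<^sup>2"
  proof -
    have "(u * v)\<^sup>2 + 4 * (c\<^sup>2)\<^sup>2 * (a - b)\<^sup>2 * e\<^sup>2 + b ^ 4 * D\<^sup>2
        = c\<^sup>2 * (4 * v\<^sup>2 * e\<^sup>2 + u\<^sup>2 * (a - b)\<^sup>2)"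
      unfolding u_def v_def D_def pyth[symmetric] side'[symmetric] by algebra
    then show ?thesis
      unfolding N_def T_def by algebra
  qed
  define x :: rat where "x = (of_int (N e) / of_int D)\<^sup>2"
  define y :: rat where "y = of_int (N e * S * T) / of_int D ^ 3"
  have x_shift: "x + of_int k ^ 4 = of_int R ^ 2 / of_int D ^ 2"
    if "(N e)\<^sup>2 + k ^ 4 * D\<^sup>2 = R\<^sup>2" for k R
  proof -
    have "x + of_int k ^ 4 = of_int ((N e)\<^sup>2 + k ^ 4 * D\<^sup>2) / of_int D ^ 2"
      using D0 by (simp add: x_def power_divide add_divide_distrib)
    then show ?thesis
      unfolding that by simp
  qed
  have abs: "of_nat (nat \<bar>k\<bar>) ^ 4 = (of_int k ^ 4 :: rat)" for k :: int
    by simp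
  have "poly (E_curve (nat \<bar>a\<bar>) (nat \<bar>b\<bar>)) x
      = (of_int (N e) / of_int D)\<^sup>2 * (of_int S ^ 2 / of_int D ^ 2) * (of_int T ^ 2 / of_int D ^ 2)"
    unfolding poly_E_curve abs x_shift[OF S] x_shift[OF T] by (simp add: x_def)
  also have "\<dots> = y\<^sup>2"
    by (simp add: y_def power2_eq_square power3_eq_cube mult_ac)
  finally have curve: "y\<^sup>2 = poly (E_curve (nat \<bar>a\<bar>) (nat \<bar>b\<bar>)) x" ..
  have x_nonint: "x \<notin> p_integral 3"
  proof
    assume "x \<in> p_integral 3"
    then obtain i n where n: "\<not> 3 dvd n" "n \<noteq> 0" "x = of_int i / of_int n"
      by (rule p_integralE)
    have "of_int ((N e)\<^sup>2 * n) = (of_int (i * D\<^sup>2) :: rat)"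
      using n(2,3) D0 by (simp add: x_def power_divide frac_eq_eq)
    then have "(N e)\<^sup>2 * n = i * D\<^sup>2"
      by (simp only: of_int_eq_iff)
    then have "3 dvd (N e)\<^sup>2 * n"
      using D3 by (simp add: power2_eq_square)
    then show False
      using n(1) e(2) by (simp add: prime_dvd_mult_iff prime_dvd_power_iff)
  qed
  interpret p_integral_cubic "E_curve (nat \<bar>a\<bar>) (nat \<bar>b\<bar>)" 3
    by (rule p_integral_cubic_E_curve) simp
  show ?thesis
    using curve x_nonint by (rule positive_rank_if_nonintegral_point)
qed

section \<open>Infinitely many triples\<close>

text \<open>
  Here \<open>(A / B\<^sup>2, G / B\<^sup>3)\<close> is the \<open>2\<^sup>k\<close>-fold multiple, up to sign, of \<open>(9/4, 15/8)\<close> on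
  \<open>w\<^sup>2 = z (z - 2) (z + 4)\<close>.  The duplication formula reads \<open>z' = ((z\<^sup>2 + 8) / (2 w))\<^sup>2\<close>,
  \<open>z' - 2 = ((z\<^sup>2 - 4 z - 8) / (2 w))\<^sup>2\<close> and \<open>z' + 4 = ((z\<^sup>2 + 8 z - 8) / (2 w))\<^sup>2\<close>.  It
  replaces \<open>B\<close> by \<open>2 B G\<close> with \<open>G\<close> odd, and so adds one factor 2.
\<close>

lemma doubling_sequence:
  "\<exists>A B G :: int. odd A \<and> odd G \<and> B \<noteq> 0 \<and> 2 ^ Suc k dvd B \<and>
    G\<^sup>2 = A ^ 3 + 2 * A\<^sup>2 * B\<^sup>2 - 8 * A * B ^ 4"
proof (induction k)
  case 0
  show ?case
    by (rule exI[of _ 9], rule exI[of _ 2], rule exI[of _ 15]) simp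
next
  case (Suc k)
  then obtain A B G :: int where 1: "odd A" "odd G" "B \<noteq> 0" "2 ^ Suc k dvd B"
    "G\<^sup>2 = A ^ 3 + 2 * A\<^sup>2 * B\<^sup>2 - 8 * A * B ^ 4"
    by blast
  define A' where "A' = (A\<^sup>2 + 8 * B ^ 4)\<^sup>2"
  define G' where "G' = (A\<^sup>2 + 8 * B ^ 4) * (A\<^sup>2 - 4 * A * B\<^sup>2 - 8 * B ^ 4)
    * (A\<^sup>2 + 8 * A * B\<^sup>2 - 8 * B ^ 4)"
  have "odd A'" "odd G'"
    using 1 by (simp_all add: A'_def G'_def)
  moreover have "2 * B * G \<noteq> 0"
    using 1 by auto
  moreover have "2 ^ Suc (Suc k) dvd 2 * B * G"
    using mult_dvd_mono[OF dvd_refl[of 2] dvd_mult2[OF 1(4), of G]] by (simp only: power_Suc mult.assoc)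
  moreover have "G'\<^sup>2 = A' ^ 3 + 2 * A'\<^sup>2 * (2 * B * G)\<^sup>2 - 8 * A' * (2 * B * G) ^ 4"
    using 1(5) unfolding A'_def G'_def by algebra
  ultimately show ?case
    by blast
qed

text \<open>
  With \<open>t = m / n\<close>, the quartic \<open>t\<^sup>4 - 2 t\<^sup>3 + 2 t\<^sup>2 + 2 t + 1\<close> is the square of \<open>t\<^sup>2 - t + h\<close> exactly
  if \<open>(2 h - 1) t\<^sup>2 - (2 h + 2) t + h\<^sup>2 - 1 = 0\<close>.  Up to a square factor, the discriminant of this
  equation in \<open>t\<close> is \<open>2 h (h + 1) (2 - h)\<close>, which for \<open>h = - z / 2\<close> is
  \<open>z (z - 2) (z + 4) / 4\<close>.  So every point of \<open>w\<^sup>2 = z (z - 2) (z + 4)\<close> gives a solution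
  \<open>t = (z - 2 + w) / (2 (z + 1))\<close>; in terms of \<open>A\<close>, \<open>B\<close>, \<open>G\<close> this is \<open>M / N\<close> below.
\<close>

lemma quartic_solutions:
  obtains m n d :: int where "odd m" "coprime m n" "n \<noteq> 0" "2 ^ k dvd n"
    "m ^ 4 - 2 * m ^ 3 * n + 2 * m\<^sup>2 * n\<^sup>2 + 2 * m * n ^ 3 + n ^ 4 = d\<^sup>2"
proof -
  obtain A B G :: int where 1: "odd A" "odd G" "B \<noteq> 0" "2 ^ Suc k dvd B"
    "G\<^sup>2 = A ^ 3 + 2 * A\<^sup>2 * B\<^sup>2 - 8 * A * B ^ 4"
    using doubling_sequence by blast
  define M where "M = A * B - 2 * B ^ 3 + G"
  define N where "N = 2 * B * (A + B\<^sup>2)"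
  define \<Delta> where "\<Delta> = M\<^sup>2 - M * N - 2 * A * (A + B\<^sup>2)\<^sup>2"
  have "even B"
    by (rule dvd_trans[OF _ 1(4)]) simp
  then have M: "odd M" and "odd (A + B\<^sup>2)"
    using 1 by (simp_all add: M_def)
  then have "A + B\<^sup>2 \<noteq> 0"
    by (metis even_zero)
  then have N0: "N \<noteq> 0"
    using 1(3) by (simp add: N_def)
  have "2 ^ k dvd B"
    by (rule dvd_trans[OF _ 1(4)]) simp
  then have N2: "2 ^ k dvd N"
    unfolding N_def by (intro dvd_mult2 dvd_mult)
  have quartic: "M ^ 4 - 2 * M ^ 3 * N + 2 * M\<^sup>2 * N\<^sup>2 + 2 * M * N ^ 3 + N ^ 4 = \<Delta>\<^sup>2"
    using 1(5) unfolding \<Delta>_def M_def N_def by algebra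
  \<comment> \<open>Reducing \<open>M / N\<close> to lowest terms keeps the powers of 2 in the denominator, as \<open>M\<close> is odd.\<close>
  define g where "g = gcd M N"
  have g0: "g \<noteq> 0"
    using N0 by (simp add: g_def)
  obtain m n where mn: "M = m * g" "N = n * g" "coprime m n"
    using gcd_coprime_exists[of M N] g0 unfolding g_def by blast
  have "(g\<^sup>2)\<^sup>2 * (m ^ 4 - 2 * m ^ 3 * n + 2 * m\<^sup>2 * n\<^sup>2 + 2 * m * n ^ 3 + n ^ 4) = \<Delta>\<^sup>2"
    using quartic unfolding mn by algebra
  moreover from this have "(g\<^sup>2)\<^sup>2 dvd \<Delta>\<^sup>2"
    by (metis dvd_triv_left)
  then have "g\<^sup>2 dvd \<Delta>"
    by (simp only: pow_divides_pow_iff[OF pos2])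
  then obtain d where "\<Delta> = g\<^sup>2 * d" ..
  ultimately have "(g\<^sup>2)\<^sup>2 * (m ^ 4 - 2 * m ^ 3 * n + 2 * m\<^sup>2 * n\<^sup>2 + 2 * m * n ^ 3 + n ^ 4)
      = (g\<^sup>2)\<^sup>2 * d\<^sup>2"
    by (simp add: power_mult_distrib)
  then have "m ^ 4 - 2 * m ^ 3 * n + 2 * m\<^sup>2 * n\<^sup>2 + 2 * m * n ^ 3 + n ^ 4 = d\<^sup>2"
    using g0 by simp
  moreover have "odd m" "odd g"
    using M mn(1) by simp_all
  moreover have "2 ^ k dvd n"
  proof -
    have "coprime (2 ^ k) g"
      using \<open>odd g\<close> by simp
    then show ?thesis
      using N2 unfolding mn(2) by (simp add: coprime_dvd_mult_left_iff)
  qed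
  moreover have "n \<noteq> 0"
    using N0 mn(2) by auto
  ultimately show thesis
    using that mn(3) by blast
qed

text \<open>
  For \<open>a = 2 m n\<close> and \<open>b = m\<^sup>2 - n\<^sup>2\<close> the value of \<open>a\<^sup>2 - a b + b\<^sup>2\<close> is the quartic form of
  \<open>quartic_solutions\<close>.  The triple is primitive because \<open>n\<close> is even and \<open>m\<close> is odd and prime to \<open>n\<close>;
  a high power of 2 in \<open>n\<close> makes \<open>a\<close> large.
\<close>

lemma large_triple:
  "\<exists>a b c. k < a \<and> primitive_pythagorean_triple a b c \<and> positive_rank (E_curve a b)"
proof -
  obtain m n d :: int where 1: "odd m" "coprime m n" "n \<noteq> 0" "2 ^ Suc k dvd n"
    "m ^ 4 - 2 * m ^ 3 * n + 2 * m\<^sup>2 * n\<^sup>2 + 2 * m * n ^ 3 + n ^ 4 = d\<^sup>2"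
    using quartic_solutions .
  define a where "a = 2 * m * n"
  define b where "b = m\<^sup>2 - n\<^sup>2"
  define c where "c = m\<^sup>2 + n\<^sup>2"
  have pyth: "a\<^sup>2 + b\<^sup>2 = c\<^sup>2"
    unfolding a_def b_def c_def by algebra
  have side: "a\<^sup>2 - a * b + b\<^sup>2 = d\<^sup>2"
    using 1(5) unfolding a_def b_def by algebra
  have "m \<noteq> 0"
    using 1(1) by auto
  then have a0: "a \<noteq> 0"
    using 1(3) by (simp add: a_def)
  have "even n"
    by (rule dvd_trans[OF _ 1(4)]) simp
  then have "odd b"
    using 1(1) by (simp add: b_def)
  then have b0: "b \<noteq> 0"
    by auto
  have "coprime m b"
  proof (rule coprimeI)
    fix q assume q: "q dvd m" "q dvd b"
    then have "q dvd m * m - b"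
      by (intro dvd_diff) simp_all
    then have "q dvd n\<^sup>2"
      by (simp add: b_def power2_eq_square)
    moreover have "coprime m (n\<^sup>2)"
      using 1(2) by simp
    ultimately show "is_unit q"
      using q(1) by (meson coprime_common_divisor)
  qed
  moreover have "coprime n b"
  proof (rule coprimeI)
    fix q assume q: "q dvd n" "q dvd b"
    then have "q dvd b + n * n"
      by (intro dvd_add) simp_all
    then have "q dvd m\<^sup>2"
      by (simp add: b_def power2_eq_square)
    moreover have "coprime (m\<^sup>2) n"
      using 1(2) by simp
    ultimately show "is_unit q"
      using q(1) by (meson coprime_common_divisor)
  qed
  ultimately have cop: "coprime a b"
    using \<open>odd b\<close> by (simp add: a_def)
  have "primitive_pythagorean_triple (nat \<bar>a\<bar>) (nat \<bar>b\<bar>) (nat \<bar>c\<bar>)"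
    unfolding primitive_pythagorean_triple_def
  proof (intro conjI)
    have "c \<noteq> 0"
      using pyth a0 by auto
    then show "0 < nat \<bar>a\<bar>" "0 < nat \<bar>b\<bar>" "0 < nat \<bar>c\<bar>"
      using a0 b0 by simp_all
    have "int ((nat \<bar>a\<bar>)\<^sup>2 + (nat \<bar>b\<bar>)\<^sup>2) = int ((nat \<bar>c\<bar>)\<^sup>2)"
      using pyth by simp
    then show "(nat \<bar>a\<bar>)\<^sup>2 + (nat \<bar>b\<bar>)\<^sup>2 = (nat \<bar>c\<bar>)\<^sup>2"
      by (simp only: of_nat_eq_iff)
    have "coprime (nat \<bar>a\<bar>) (nat \<bar>b\<bar>)"
      using cop by simp
    then have "gcd (gcd (nat \<bar>a\<bar>) (nat \<bar>b\<bar>)) (nat \<bar>c\<bar>) = 1"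
      by (simp only: coprime_iff_gcd_eq_1) simp
    then show "gcd (nat \<bar>a\<bar>) (gcd (nat \<bar>b\<bar>) (nat \<bar>c\<bar>)) = 1"
      by (simp only: gcd.assoc)
  qed
  moreover have "positive_rank (E_curve (nat \<bar>a\<bar>) (nat \<bar>b\<bar>))"
    using pyth side cop a0 b0 by (rule positive_rank_E_curve)
  moreover have "k < nat \<bar>a\<bar>"
  proof -
    have "2 ^ Suc k dvd a"
      using 1(4) unfolding a_def by (rule dvd_mult)
    then have "2 * 2 ^ k \<le> \<bar>a\<bar>"
      using dvd_imp_le_int[OF a0] by fastforce
    moreover have "int k < 2 ^ k"
      by (rule of_nat_less_two_power)
    ultimately have "int k < \<bar>a\<bar>"
      by linarith
    then show ?thesis
      by linarith
  qed
  ultimately show ?thesis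
    by blast
qed

theorem theorem3p1:
  "infinite {(a, b, c). primitive_pythagorean_triple a b c
     \<and> elliptic_curve (E_curve a b) \<and> positive_rank (E_curve a b)}"
  (is "infinite ?S")
proof
  assume "finite ?S"
  then have "finite (fst ` ?S)"
    by (rule finite_imageI)
  then obtain k where k: "\<forall>a \<in> fst ` ?S. a \<le> k"
    using finite_nat_set_iff_bounded_le by blast
  obtain a b c where "k < a" and abc: "primitive_pythagorean_triple a b c"
    "positive_rank (E_curve a b)"
    using large_triple by blast
  have "elliptic_curve (E_curve a b)"
    using abc(1) by (rule primitive_pythagorean_triple_elliptic_curve)
  then have "(a, b, c) \<in> ?S"
    using abc by simp
  then have "a \<in> fst ` ?S"
    by force
  then show False
    using k \<open>k < a\<close> by fastforce
qed

end
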